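(* Let $\bar A$ specify a random graph with independent edges satisfying $(\epsilon,\delta)$-concentration for some $\epsilon,\delta\in(0,1)$, and let $\beta>0$ and $b\in\mathbb{R}^n_{\ge0}$. Then with probability at least $1-\delta$ over the draw of $A$ from $\bar A$, the following holds: if the spectral radius of $A$ is less than $1/\beta$, then there is $C_0$ such that for every budget $C\ge C_0$ the intervention $y=\sqrt C\,v_1(\bar A)$ has competitive ratio $W(y)/W(y^* )\ge1-\epsilon$ in the network game on $A$.
   Context: Random graph with independent edges: given a symmetric $\bar A\in[0,1]^{n\times n}$, a graph with adjacency matrix $A$ is sampled by including each edge $\{i,j\}$ independently with probability $\bar A_{ij}$. $v_1(\bar A)$ is the unit eigenvector for the largest eigenvalue $\lambda_1(\bar A)$, with the sign chosen to have nonnegative entries. The inverted spectral gap of $\bar A$ is the smallest $\kappa$ with $|\lambda_i(\bar A)|\le\kappa\lambda_1(\bar A)$ for all $i>1$. $\bar A$ satisfies $(\epsilon,\delta)$-concentration if: (1) the maximum expected degree $d_{\max}=\max_i\sum_j\bar A_{ij}$ is at least $\frac49\log(2n/\delta)$; (2) the inverted spectral gap of $\bar A$ is at most $\kappa$ for some $\kappa<1$; (3) $\lambda_1(\bar A)(1-\kappa^2)\ge\frac{1024\sqrt{d_{\max}\log(2n/\delta)}}{\epsilon^2}$. Network game: agent $i$ has utility $u_i(a)=b_ia_i-\tfrac12a_i^2+\beta\sum_jA_{ij}a_ia_j$; $M=I-\beta A$; an intervention $y$ replaces $b$ by $b+y$ and yields equilibrium welfare $W(y)=\tfrac12\|M^{-1}(b+y)\|^2$;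 the optimal intervention of budget $C$ is $y^*\in\arg\max_{\|x\|=\sqrt C}W(x)$; the competitive ratio of $y$ is $W(y)/W(y^* )$. *)

theory Defs
  imports "Jordan_Normal_Form.Spectral_Radius" "HOL-Probability.Product_PMF"
begin

(* Eigenvalues (with multiplicity) of a real square matrix: the real roots of its
   characteristic polynomial.  For symmetric real matrices these are all eigenvalues. *)
definition eigvals :: "real mat \<Rightarrow> real multiset" where
  "eigvals A = proots (char_poly A)"

definition lambda1 :: "real mat \<Rightarrow> real" where
  "lambda1 A = Max (set_mset (eigvals A))"

definition other_eigvals :: "real mat \<Rightarrow> real multiset" where
  "other_eigvals A = eigvals A - {# lambda1 A #}"

definition vnorm :: "real Matrix.vec \<Rightarrow> real" where
  "vnorm x = sqrt (scalar_prod x x)"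

definition v1 :: "real mat \<Rightarrow> real Matrix.vec" where
  "v1 A = (SOME v. v \<in> carrier_vec (dim_row A) \<and> eigenvector A v (lambda1 A) \<and>
              vnorm v = 1 \<and> (\<forall>i < dim_row A. vec_index v i \<ge> 0))"

(* "the inverted spectral gap of A is at most kappa" (the inverted spectral gap is the
   smallest such kappa, and the condition is upward closed) *)
definition inv_gap_le :: "real mat \<Rightarrow> real \<Rightarrow> bool" where
  "inv_gap_le A \<kappa> \<longleftrightarrow> (\<forall>\<mu> \<in># other_eigvals A. \<bar>\<mu>\<bar> \<le> \<kappa> * lambda1 A)"

definition d_max :: "nat \<Rightarrow> real mat \<Rightarrow> real" where
  "d_max n Ab = Max {(\<Sum>j<n. Ab $$ (i, j)) | i. i < n}"

definition concentration :: "nat \<Rightarrow> real mat \<Rightarrow> real \<Rightarrow> real \<Rightarrow> bool" where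
  "concentration n Ab \<epsilon> \<delta> \<longleftrightarrow>
     d_max n Ab \<ge> 4/9 * ln (2 * real n / \<delta>) \<and>
     (\<exists>\<kappa> < 1. inv_gap_le Ab \<kappa> \<and>
        lambda1 Ab * (1 - \<kappa>^2) \<ge> 1024 * sqrt (d_max n Ab * ln (2 * real n / \<delta>)) / \<epsilon>^2)"

definition edge_prob_matrix :: "nat \<Rightarrow> real mat \<Rightarrow> bool" where
  "edge_prob_matrix n Ab \<longleftrightarrow> Ab \<in> carrier_mat n n \<and>
     (\<forall>i<n. \<forall>j<n. Ab $$ (i, j) = Ab $$ (j, i) \<and> 0 \<le> Ab $$ (i, j) \<and> Ab $$ (i, j) \<le> 1)"

(* Random graph with independent edges: each unordered pair {i,j} (i \<le> j, loops allowed
   exactly when Ab(i,i) > 0) is an edge independently with probability Ab(i,j). *)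
definition random_graph :: "nat \<Rightarrow> real mat \<Rightarrow> real mat pmf" where
  "random_graph n Ab =
     map_pmf (\<lambda>E. Matrix.mat n n (\<lambda>(i, j). if E (min i j, max i j) then 1 else 0))
       (Pi_pmf {(i, j). i \<le> j \<and> j < n} False (\<lambda>(i, j). bernoulli_pmf (Ab $$ (i, j))))"

definition welfare :: "nat \<Rightarrow> real \<Rightarrow> real mat \<Rightarrow> real Matrix.vec \<Rightarrow> real Matrix.vec \<Rightarrow> real" where
  "welfare n \<beta> A b y =
     (let M = 1\<^sub>m n - \<beta> \<cdot>\<^sub>m A in (1/2) * (vnorm (the (mat_inverse M) *\<^sub>v (b + y)))^2)"

definition opt_welfare :: "nat \<Rightarrow> real \<Rightarrow> real mat \<Rightarrow> real Matrix.vec \<Rightarrow> real \<Rightarrow> real" where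
  "opt_welfare n \<beta> A b C =
     Sup {welfare n \<beta> A b x | x. x \<in> carrier_vec n \<and> vnorm x = sqrt C}"

definition competitive_ratio :: "nat \<Rightarrow> real \<Rightarrow> real mat \<Rightarrow> real Matrix.vec \<Rightarrow> real \<Rightarrow> real Matrix.vec \<Rightarrow> real" where
  "competitive_ratio n \<beta> A b C y = welfare n \<beta> A b y / opt_welfare n \<beta> A b C"

end

theory Submission
  imports Defs
begin

text \<open>
  Write \<open>X\<close> for the difference between the sampled matrix and the matrix of edge probabilities, \<open>d\<close>
  for the maximal expected degree and \<open>L\<close> for \<open>ln (2n/\<delta>)\<close>. The expected trace of the \<open>2k\<close>-th power
  of \<open>X\<close> is a sum over closed walks, of which only those contribute that traverse every edge at
  least twice. Along such a walk a step over a new edge contributes at most \<open>d\<close> in total, a step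
  over an old edge has at most \<open>k\<close> targets, and there are at most \<open>k\<close> distinct edges; so the
  expected trace is at most \<open>n (4Dk)\<^sup>k\<close> for any \<open>D\<close> at least \<open>d\<close> and \<open>k\<close>. With \<open>k = \<lceil>L\<rceil>\<close> and
  \<open>D = 7d\<close>, Markov's inequality bounds the quadratic form of \<open>X\<close> on unit vectors by
  \<open>16 sqrt (dL)\<close> with probability at least \<open>1 - \<delta>\<close>.

  On this event, comparing Rayleigh quotients shows that the top eigenvectors \<open>u\<close> of the sampled
  matrix \<open>A\<close> and \<open>v\<close> of the mean satisfy \<open>(1 - (u, v)\<^sup>2) (1 - \<kappa>) \<lambda> \<le> 32 sqrt (dL)\<close>, where \<open>\<lambda>\<close> is the
  top eigenvalue of the mean; hence \<open>(u, v)\<^sup>2 > 1 - \<epsilon>\<close>. By Rayleigh and Cauchy--Schwarz the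
  equilibrium \<open>z\<close> for incentives \<open>x\<close> satisfies \<open>\<bar>(u, x)\<bar> \<le> (1 - \<beta> \<lambda>\<^sub>1(A)) \<parallel>z\<parallel> \<le> \<parallel>x\<parallel>\<close>, so for large
  budgets the competitive ratio is at least a quantity that tends to \<open>(u, v)\<^sup>2\<close>.
\<close>

unbundle no inner_syntax and no vec_syntax

section \<open>Real vectors and orthonormal matrices\<close>

lemma scalar_prod_eq_sum: "y \<in> carrier_vec n \<Longrightarrow> x \<bullet> y = (\<Sum>i<n. x $ i * y $ i)"
  by (simp add: scalar_prod_def lessThan_atLeast0)

lemma scalar_prod_self_nonneg: "0 \<le> (x :: real Matrix.vec) \<bullet> x"
  by (simp add: scalar_prod_def sum_nonneg)

lemma vnorm_nonneg: "0 \<le> vnorm x"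
  by (simp add: vnorm_def scalar_prod_self_nonneg)

lemma vnorm_squared: "(vnorm x)\<^sup>2 = x \<bullet> x"
  by (simp add: vnorm_def scalar_prod_self_nonneg)

lemma vnorm_eq_1_iff: "vnorm x = 1 \<longleftrightarrow> x \<bullet> x = 1"
  by (simp add: vnorm_def)

lemma vnorm_smult:
  assumes "x \<in> carrier_vec n"
  shows "vnorm (c \<cdot>\<^sub>v x) = \<bar>c\<bar> * vnorm x"
  using assms by (simp add: vnorm_def real_sqrt_mult flip: mult.assoc)

lemma vnorm_pos:
  assumes "x \<in> carrier_vec n" "x \<noteq> 0\<^sub>v n"
  shows "0 < vnorm x"
  using conjugate_square_greater_0_vec[OF assms(1)] assms(2) by (simp add: vnorm_def)

lemma abs_scalar_prod_le_vnorm: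
  assumes "x \<in> carrier_vec n" "y \<in> carrier_vec n"
  shows "\<bar>x \<bullet> y\<bar> \<le> vnorm x * vnorm y"
proof (rule power2_le_imp_le)
  have "(x \<bullet> y)\<^sup>2 \<le> (x \<bullet> x) * (y \<bullet> y)"
    using Cauchy_Schwarz_ineq_sum[of "\<lambda>i. x $ i" "\<lambda>i. y $ i" "{..<n}"] assms
    by (simp add: scalar_prod_eq_sum power2_eq_square)
  then show "\<bar>x \<bullet> y\<bar>\<^sup>2 \<le> (vnorm x * vnorm y)\<^sup>2"
    by (simp add: power_mult_distrib vnorm_squared)
qed (simp add: vnorm_nonneg)

lemma vnorm_triangle_ineq:
  assumes x: "x \<in> carrier_vec n" and y: "y \<in> carrier_vec n"
  shows "vnorm (x + y) \<le> vnorm x + vnorm y"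
proof (rule power2_le_imp_le)
  have "(x + y) \<bullet> (x + y) = x \<bullet> x + 2 * (x \<bullet> y) + y \<bullet> y"
    using x y comm_scalar_prod[OF y x]
    by (simp add: add_scalar_prod_distrib[of _ n] scalar_prod_add_distrib[of _ n])
  also have "x \<bullet> y \<le> vnorm x * vnorm y"
    using abs_scalar_prod_le_vnorm[OF x y] by simp
  finally show "(vnorm (x + y))\<^sup>2 \<le> (vnorm x + vnorm y)\<^sup>2"
    by (simp add: vnorm_squared power2_sum)
qed (simp add: vnorm_nonneg)

lemma unit_eigenvector_exists:
  fixes A :: "real mat"
  assumes A: "A \<in> carrier_mat n n" and "eigenvalue A e"
  obtains v where "v \<in> carrier_vec n" "vnorm v = 1" "A *\<^sub>v v = e \<cdot>\<^sub>v v"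
proof -
  obtain w where w: "w \<in> carrier_vec n" "w \<noteq> 0\<^sub>v n" "A *\<^sub>v w = e \<cdot>\<^sub>v w"
    using assms by (auto simp: eigenvalue_def eigenvector_def)
  define v where "v = (1 / vnorm w) \<cdot>\<^sub>v w"
  have "vnorm v = 1"
    using vnorm_pos[OF w(1,2)] by (simp add: v_def vnorm_smult[OF w(1)])
  moreover have "A *\<^sub>v v = e \<cdot>\<^sub>v v"
    unfolding v_def mult_mat_vec[OF A w(1)] w(3) by (simp add: smult_smult_assoc mult.commute)
  ultimately show thesis
    using that[of v] w(1) by (simp add: v_def)
qed

definition symmetric_mat :: "nat \<Rightarrow> 'a mat \<Rightarrow> bool" where
  "symmetric_mat n A \<longleftrightarrow> A \<in> carrier_mat n n \<and> A\<^sup>T = A"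

lemma symmetric_mat_carrier: "symmetric_mat n A \<Longrightarrow> A \<in> carrier_mat n n"
  by (simp add: symmetric_mat_def)

lemma symmetric_mat_index:
  assumes "symmetric_mat n A" "i < n" "j < n"
  shows "A $$ (i, j) = A $$ (j, i)"
  using assms index_transpose_mat(1)[of j A i] by (auto simp: symmetric_mat_def)

lemma symmetric_matI:
  assumes "A \<in> carrier_mat n n" "\<And>i j. i < n \<Longrightarrow> j < n \<Longrightarrow> A $$ (i, j) = A $$ (j, i)"
  shows "symmetric_mat n A"
  using assms by (auto simp: symmetric_mat_def)

lemma scalar_prod_symmetric_mat:
  fixes A :: "'a :: comm_semiring_0 mat"
  assumes "symmetric_mat n A" "x \<in> carrier_vec n" "y \<in> carrier_vec n"
  shows "(A *\<^sub>v x) \<bullet> y = x \<bullet> (A *\<^sub>v y)"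
  using transpose_vec_mult_scalar[of A n n y x] assms by (simp add: symmetric_mat_def)

definition orthonormal_mat :: "nat \<Rightarrow> 'a :: semiring_1 mat \<Rightarrow> bool" where
  "orthonormal_mat n Q \<longleftrightarrow> Q \<in> carrier_mat n n \<and> Q\<^sup>T * Q = 1\<^sub>m n"

lemma orthonormal_mat_carrier: "orthonormal_mat n Q \<Longrightarrow> Q \<in> carrier_mat n n"
  by (simp add: orthonormal_mat_def)

lemma orthonormal_mat_mult_transpose:
  fixes Q :: "'a :: field mat"
  shows "orthonormal_mat n Q \<Longrightarrow> Q * Q\<^sup>T = 1\<^sub>m n"
  using mat_mult_left_right_inverse[of "Q\<^sup>T" n Q] by (simp add: orthonormal_mat_def)

lemma congruence_mult:
  fixes A P Q :: "'a :: comm_semiring_0 mat"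
  assumes "A \<in> carrier_mat n n" "P \<in> carrier_mat n n" "Q \<in> carrier_mat n n"
  shows "(P * Q)\<^sup>T * A * (P * Q) = Q\<^sup>T * (P\<^sup>T * A * P) * Q"
  using assms by (simp add: transpose_mult[of _ n n _ n] assoc_mult_mat[of _ n n _ n _ n])

lemma orthonormal_mat_mult:
  fixes P Q :: "'a :: comm_semiring_1 mat"
  assumes P: "orthonormal_mat n P" and Q: "orthonormal_mat n Q"
  shows "orthonormal_mat n (P * Q)"
  using congruence_mult[of "1\<^sub>m n" n P Q] P Q by (auto simp: orthonormal_mat_def)

lemma symmetric_mat_congruence:
  fixes A P :: "'a :: comm_semiring_0 mat"
  assumes "symmetric_mat n A" "P \<in> carrier_mat n n"
  shows "symmetric_mat n (P\<^sup>T * A * P)"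
  using assms by (simp add: symmetric_mat_def transpose_mult[of _ n n _ n]
      assoc_mult_mat[of _ n n _ n _ n] mult_carrier_mat[of _ n n _ n])

lemma orthonormal_mat_of_normalized_cols:
  assumes ws: "set ws \<subseteq> carrier_vec n" "corthogonal ws" "length ws = n"
  defines "H \<equiv> mat_of_cols n (map (\<lambda>w. (1 / vnorm w) \<cdot>\<^sub>v w) ws)"
  shows "orthonormal_mat n H"
proof -
  have H: "H \<in> carrier_mat n n"
    using ws(3) by (auto simp: H_def)
  have nth: "ws ! i \<in> carrier_vec n" if "i < n" for i
    using ws(1,3) that by auto
  have col: "col H i = (1 / vnorm (ws ! i)) \<cdot>\<^sub>v ws ! i" if "i < n" for i
    unfolding H_def using ws(3) nth[OF that] that by (subst col_mat_of_cols) auto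
  have "H\<^sup>T * H = 1\<^sub>m n"
  proof (rule eq_matI)
    fix i j assume "i < dim_row (1\<^sub>m n :: real mat)" "j < dim_col (1\<^sub>m n :: real mat)"
    then have ij: "i < n" "j < n" by simp_all
    have "(H\<^sup>T * H) $$ (i, j) = (ws ! i \<bullet> ws ! j) / (vnorm (ws ! i) * vnorm (ws ! j))"
      using ij H nth[OF ij(1)] nth[OF ij(2)] by (simp add: col)
    also have "\<dots> = of_bool (i = j)"
      using corthogonalD[OF ws(2), of i j] ij ws(3) vnorm_squared[of "ws ! i"]
      by (auto simp: power2_eq_square)
    finally show "(H\<^sup>T * H) $$ (i, j) = 1\<^sub>m n $$ (i, j)" using ij by simp
  qed (use H in auto)
  then show ?thesis
    using H by (simp add: orthonormal_mat_def)
qed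

lemma unit_vec_extends_to_orthonormal_mat:
  assumes v: "v \<in> carrier_vec n" and "vnorm v = 1"
  obtains H where "orthonormal_mat n H" "col H 0 = v"
proof -
  interpret cof_vec_space n "TYPE(real)" .
  have v0: "v \<noteq> 0\<^sub>v n"
    using \<open>vnorm v = 1\<close> by (auto simp: vnorm_def)
  then have n: "0 < n"
    using v by (cases n) (auto intro: eq_vecI)
  define ws where "ws = gram_schmidt n (basis_completion v)"
  note basis = basis_completion[OF v v0]
  have ws: "set ws \<subseteq> carrier_vec n" "corthogonal ws" "length ws = n"
    using gram_schmidt_result[OF basis(2,4,5) ws_def] basis(6) by auto
  have "hd ws = v"
    using gram_schmidt_hd[OF v] by (simp add: ws_def basis_completion_def Let_def)
  then have first: "ws ! 0 = v"
    using ws(3) n by (cases ws) auto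
  have "col (mat_of_cols n (map (\<lambda>w. (1 / vnorm w) \<cdot>\<^sub>v w) ws)) 0 = v"
    using n v ws(3) first \<open>vnorm v = 1\<close> by (subst col_mat_of_cols) auto
  then show thesis
    using that orthonormal_mat_of_normalized_cols[OF ws] by blast
qed

section \<open>Diagonalisation of real symmetric matrices\<close>

lemma eigenvalue_symmetric_mat_real:
  assumes A: "symmetric_mat n A" and "eigenvalue (map_mat complex_of_real A) a"
  shows "a \<in> \<real>"
proof -
  define C where "C = map_mat complex_of_real A"
  have C: "C \<in> carrier_mat n n" "C\<^sup>T = C"
    using A by (auto simp: C_def symmetric_mat_def map_mat_transpose)
  obtain v where v: "v \<in> carrier_vec n" "v \<noteq> 0\<^sub>v n" "C *\<^sub>v v = a \<cdot>\<^sub>v v"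
    using assms(2) C by (auto simp: eigenvalue_def eigenvector_def C_def)
  have "C *\<^sub>v conjugate v = conjugate (C *\<^sub>v v)"
    using C(1) v(1) by (intro eq_vecI) (auto simp: C_def scalar_prod_def)
  also have "\<dots> = cnj a \<cdot>\<^sub>v conjugate v"
    by (simp add: v(3) conjugate_smult_vec)
  finally have "cnj a * (v \<bullet>c v) = (C *\<^sub>v conjugate v) \<bullet> v"
    using v(1) comm_scalar_prod[of v n "conjugate v"] by simp
  also have "\<dots> = conjugate v \<bullet> (C *\<^sub>v v)"
    using transpose_vec_mult_scalar[OF C(1) v(1), of "conjugate v"] C(2) v(1) by simp
  also have "\<dots> = a * (v \<bullet>c v)"
    using v comm_scalar_prod[of v n "conjugate v"] by simp
  finally show ?thesis
    using conjugate_square_eq_0_vec[OF v(1)] v(2) by (simp add: Reals_cnj_iff)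
qed

lemma symmetric_mat_has_eigenvalue:
  fixes A :: "real mat"
  assumes A: "symmetric_mat n A" and n: "0 < n"
  obtains e where "eigenvalue A e"
proof -
  have C: "map_mat complex_of_real A \<in> carrier_mat n n"
    using symmetric_mat_carrier[OF A] by simp
  then obtain a where a: "eigenvalue (map_mat complex_of_real A) a"
    using spectrum_non_empty[OF C n] by (auto simp: spectrum_def)
  then obtain e where "a = complex_of_real e"
    using eigenvalue_symmetric_mat_real[OF A] by (auto elim: Reals_cases)
  with a have "poly (map_poly complex_of_real (char_poly A)) (complex_of_real e) = 0"
    using eigenvalue_root_char_poly[OF C]
    by (simp add: of_real_hom.char_poly_hom[OF symmetric_mat_carrier[OF A]])
  then have "poly (char_poly A) e = 0"
    by (simp add: of_real_hom.poly_map_poly)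
  then show thesis
    using that eigenvalue_root_char_poly[OF symmetric_mat_carrier[OF A]] by blast
qed

definition bordered_mat :: "'a :: zero \<Rightarrow> 'a mat \<Rightarrow> 'a mat" where
  "bordered_mat a B =
     four_block_mat (Matrix.mat 1 1 (\<lambda>_. a)) (0\<^sub>m 1 (dim_col B)) (0\<^sub>m (dim_row B) 1) B"

lemma bordered_mat_carrier: "B \<in> carrier_mat m m \<Longrightarrow> bordered_mat a B \<in> carrier_mat (Suc m) (Suc m)"
  by (auto simp: bordered_mat_def)

lemma bordered_mat_mult:
  fixes B C :: "'a :: semiring_0 mat"
  assumes "B \<in> carrier_mat m m" "C \<in> carrier_mat m m"
  shows "bordered_mat a B * bordered_mat c C = bordered_mat (a * c) (B * C)"
proof -
  have "Matrix.mat 1 1 (\<lambda>_. a) * Matrix.mat 1 1 (\<lambda>_. c) = Matrix.mat 1 1 (\<lambda>_. a * c)"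
    by (intro eq_matI) (auto simp: scalar_prod_def)
  then show ?thesis
    unfolding bordered_mat_def using assms by (subst mult_four_block_mat[of _ 1 1 _ m _ m]) auto
qed

lemma bordered_mat_transpose: "B \<in> carrier_mat m m \<Longrightarrow> (bordered_mat a B)\<^sup>T = bordered_mat a B\<^sup>T"
  unfolding bordered_mat_def by (subst transpose_four_block_mat[of _ 1 1 _ m _ m]) auto

lemma bordered_mat_diag: "bordered_mat a (mat_diag m \<mu>) = mat_diag (Suc m) (case_nat a \<mu>)"
  by (intro eq_matI) (auto simp: bordered_mat_def mat_diag_def split: nat.split)

lemma bordered_mat_one: "bordered_mat 1 (1\<^sub>m m) = 1\<^sub>m (Suc m)"
  by (intro eq_matI) (auto simp: bordered_mat_def)

lemma orthonormal_bordered_mat: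
  fixes Q :: "'a :: semiring_1 mat"
  assumes "orthonormal_mat m Q"
  shows "orthonormal_mat (Suc m) (bordered_mat 1 Q)"
  using assms by (auto simp: orthonormal_mat_def bordered_mat_carrier bordered_mat_transpose
      bordered_mat_mult[of _ m] bordered_mat_one)

lemma symmetric_mat_deflation:
  fixes A :: "real mat"
  assumes A: "symmetric_mat (Suc m) A"
  obtains H e B where "orthonormal_mat (Suc m) H" "symmetric_mat m B"
    "H\<^sup>T * A * H = bordered_mat e B"
proof -
  note Ac = symmetric_mat_carrier[OF A]
  obtain e where "eigenvalue A e"
    using symmetric_mat_has_eigenvalue[OF A] by auto
  then obtain v where v: "v \<in> carrier_vec (Suc m)" "vnorm v = 1" "A *\<^sub>v v = e \<cdot>\<^sub>v v"
    using unit_eigenvector_exists[OF Ac] by blast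
  obtain H where H: "orthonormal_mat (Suc m) H" and Hv: "col H 0 = v"
    using unit_vec_extends_to_orthonormal_mat[OF v(1,2)] by blast
  note Hc = orthonormal_mat_carrier[OF H]
  define S where "S = H\<^sup>T * A * H"
  have S: "symmetric_mat (Suc m) S"
    unfolding S_def by (rule symmetric_mat_congruence[OF A Hc])
  note Sc = symmetric_mat_carrier[OF S]
  have first_col: "S $$ (i, 0) = e * of_bool (i = 0)" if i: "i < Suc m" for i
  proof -
    have "col (A * H) 0 = e \<cdot>\<^sub>v col H 0"
      using col_mult2[OF Ac Hc, of 0] v(3) by (simp add: Hv)
    then have "S $$ (i, 0) = col H i \<bullet> (e \<cdot>\<^sub>v col H 0)"
      using i Ac Hc by (simp add: S_def assoc_mult_mat[of _ "Suc m" "Suc m" _ "Suc m" _ "Suc m"])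
    also have "\<dots> = e * (H\<^sup>T * H) $$ (i, 0)"
      using i Hc by simp
    finally show ?thesis using H i by (simp add: orthonormal_mat_def)
  qed
  have first_row: "S $$ (0, i) = e * of_bool (i = 0)" if "i < Suc m" for i
    using first_col[OF that] symmetric_mat_index[OF S that] by simp
  define B where "B = Matrix.mat m m (\<lambda>(i, j). S $$ (Suc i, Suc j))"
  have "symmetric_mat m B"
    by (rule symmetric_matI) (auto simp: B_def intro: symmetric_mat_index[OF S])
  moreover have "S = bordered_mat e B"
    using Sc first_col first_row
    by (intro eq_matI) (auto simp: bordered_mat_def B_def)
  ultimately show thesis
    using that H unfolding S_def by blast
qed

locale orthonormal_diagonalization =
  fixes n :: nat and A Q :: "real mat" and \<mu> :: "nat \<Rightarrow> real"
  assumes A: "A \<in> carrier_mat n n"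
    and Q: "orthonormal_mat n Q"
    and diag: "Q\<^sup>T * A * Q = mat_diag n \<mu>"

lemma symmetric_mat_diagonalizable:
  assumes "symmetric_mat n A"
  shows "\<exists>Q \<mu>. orthonormal_diagonalization n A Q \<mu>"
  using assms
proof (induction n arbitrary: A)
  case 0
  then have "orthonormal_diagonalization 0 A (1\<^sub>m 0) \<mu>" for \<mu>
    by unfold_locales (auto simp: symmetric_mat_def orthonormal_mat_def mat_diag_def)
  then show ?case by blast
next
  case (Suc m)
  obtain H e B where H: "orthonormal_mat (Suc m) H" and B: "symmetric_mat m B"
    and HAH: "H\<^sup>T * A * H = bordered_mat e B"
    using symmetric_mat_deflation[OF Suc.prems] .
  obtain R \<mu> where "orthonormal_diagonalization m B R \<mu>"
    using Suc.IH[OF B] by blast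
  then interpret B: orthonormal_diagonalization m B R \<mu> .
  note A = symmetric_mat_carrier[OF Suc.prems] and Hc = orthonormal_mat_carrier[OF H]
    and R = orthonormal_mat_carrier[OF B.Q]
  let ?F = "bordered_mat 1 R"
  have F: "orthonormal_mat (Suc m) ?F" by (rule orthonormal_bordered_mat[OF B.Q])
  have "(H * ?F)\<^sup>T * A * (H * ?F) = ?F\<^sup>T * bordered_mat e B * ?F"
    using congruence_mult[OF A Hc bordered_mat_carrier[OF R]] HAH by simp
  also have "\<dots> = bordered_mat e (R\<^sup>T * B * R)"
    using R B.A by (simp add: bordered_mat_transpose bordered_mat_mult[of _ m])
  finally have "orthonormal_diagonalization (Suc m) A (H * ?F) (case_nat e \<mu>)"
    using A orthonormal_mat_mult[OF H F] by unfold_locales (simp_all add: B.diag bordered_mat_diag)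
  then show ?case by blast
qed

context orthonormal_diagonalization
begin

lemma similar_mat_diag: "similar_mat_wit A (mat_diag n \<mu>) Q Q\<^sup>T"
proof (rule similar_mat_wit_sym, rule similar_mat_witI)
  show "Q\<^sup>T * Q = 1\<^sub>m n" "Q * Q\<^sup>T = 1\<^sub>m n"
    using Q orthonormal_mat_mult_transpose[OF Q] by (simp_all add: orthonormal_mat_def)
qed (use A orthonormal_mat_carrier[OF Q] in \<open>simp_all add: diag[symmetric]\<close>)

lemma eigvals_eq: "eigvals A = image_mset \<mu> (mset_set {..<n})"
proof -
  have "char_poly A = char_poly (mat_diag n \<mu>)"
    using similar_mat_diag by (intro char_poly_similar) (auto simp: similar_mat_def)
  also have "\<dots> = (\<Prod>a\<leftarrow>diag_mat (mat_diag n \<mu>). [:- a, 1:])"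
    by (rule char_poly_upper_triangular[of _ n]) (auto simp: mat_diag_def)
  also have "\<dots> = (\<Prod>i<n. [:- \<mu> i, 1:])"
    by (simp add: diag_mat_def mat_diag_def comp_def prod.list_conv_set_nth lessThan_atLeast0)
  finally have "eigvals A = (\<Sum>i<n. {#\<mu> i#})"
    by (simp add: eigvals_def proots_prod)
  then show ?thesis
    by (simp add: sum_unfold_sum_mset)
qed

lemma lambda1_ge: "i < n \<Longrightarrow> \<mu> i \<le> lambda1 A"
  by (simp add: lambda1_def eigvals_eq)

lemma lambda1_attained:
  assumes "0 < n"
  obtains t where "t < n" "\<mu> t = lambda1 A"
    and "other_eigvals A = image_mset \<mu> (mset_set ({..<n} - {t}))"
proof -
  have "Max (\<mu> ` {..<n}) \<in> \<mu> ` {..<n}"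
    using assms by (intro Max_in) auto
  then have "lambda1 A \<in> \<mu> ` {..<n}"
    by (simp add: lambda1_def eigvals_eq)
  then obtain t where t: "t < n" "\<mu> t = lambda1 A"
    by auto
  then show thesis
    using that mset_set.remove[of "{..<n}" t] by (simp add: other_eigvals_def eigvals_eq)
qed

definition coord :: "real Matrix.vec \<Rightarrow> real Matrix.vec" where
  "coord x = Q\<^sup>T *\<^sub>v x"

lemma coord_carrier [simp]: "x \<in> carrier_vec n \<Longrightarrow> coord x \<in> carrier_vec n"
  using orthonormal_mat_carrier[OF Q] by (simp add: coord_def)

lemma dim_coord [simp]: "dim_vec (coord x) = n"
  using orthonormal_mat_carrier[OF Q] by (simp add: coord_def)

lemma coord_inverse: "x \<in> carrier_vec n \<Longrightarrow> Q *\<^sub>v coord x = x"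
  using assoc_mult_mat_vec[of Q n n "Q\<^sup>T" n x] orthonormal_mat_carrier[OF Q]
    orthonormal_mat_mult_transpose[OF Q]
  by (simp add: coord_def)

lemma coord_inj: "x \<in> carrier_vec n \<Longrightarrow> y \<in> carrier_vec n \<Longrightarrow> coord x = coord y \<Longrightarrow> x = y"
  by (metis coord_inverse)

lemma coord_smult: "x \<in> carrier_vec n \<Longrightarrow> coord (c \<cdot>\<^sub>v x) = c \<cdot>\<^sub>v coord x"
  using orthonormal_mat_carrier[OF Q] by (simp add: coord_def mult_mat_vec[of _ n n])

lemma coord_mult_mat_vec:
  assumes x: "x \<in> carrier_vec n" and i: "i < n"
  shows "coord (A *\<^sub>v x) $ i = \<mu> i * coord x $ i"
proof -
  have "coord (A *\<^sub>v x) = Q\<^sup>T *\<^sub>v (A *\<^sub>v (Q *\<^sub>v coord x))"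
    using x by (simp add: coord_inverse) (simp add: coord_def)
  also have "\<dots> = mat_diag n \<mu> *\<^sub>v coord x"
    using x A orthonormal_mat_carrier[OF Q]
    by (simp add: assoc_mult_mat_vec[of _ n n _ n] flip: diag)
  finally have "coord (A *\<^sub>v x) $ i = (\<Sum>j<n. (if i = j then \<mu> j else 0) * coord x $ j)"
    using i coord_carrier[OF x] by (simp add: mat_diag_def scalar_prod_eq_sum[of _ n])
  also have "\<dots> = \<mu> i * coord x $ i"
    using i by (simp add: if_distrib[of "\<lambda>z. z * _"] cong: if_cong)
  finally show ?thesis .
qed

lemma coord_eigenvector_eq_0:
  assumes x: "x \<in> carrier_vec n" and Ax: "A *\<^sub>v x = e \<cdot>\<^sub>v x" and i: "i < n" "\<mu> i \<noteq> e"
  shows "coord x $ i = 0"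
  using coord_mult_mat_vec[OF x i(1)] coord_smult[OF x] i by (simp add: Ax)

lemma scalar_prod_coord:
  assumes "x \<in> carrier_vec n" "y \<in> carrier_vec n"
  shows "x \<bullet> y = (\<Sum>i<n. coord x $ i * coord y $ i)"
proof -
  have "coord x \<bullet> coord y = x \<bullet> (Q *\<^sub>v coord y)"
    using transpose_vec_mult_scalar[OF orthonormal_mat_carrier[OF Q] coord_carrier[OF assms(2)]
        assms(1)]
    by (simp add: coord_def)
  then show ?thesis
    using assms by (simp add: coord_inverse scalar_prod_eq_sum[of _ n])
qed

lemma scalar_prod_self_coord:
  "x \<in> carrier_vec n \<Longrightarrow> x \<bullet> x = (\<Sum>i<n. (coord x $ i)\<^sup>2)"
  by (simp add: scalar_prod_coord power2_eq_square)

lemma quadratic_form_coord: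
  "x \<in> carrier_vec n \<Longrightarrow> x \<bullet> (A *\<^sub>v x) = (\<Sum>i<n. \<mu> i * (coord x $ i)\<^sup>2)"
  using A by (simp add: scalar_prod_coord coord_mult_mat_vec power2_eq_square mult_ac)

end

section \<open>Rayleigh quotients\<close>

lemma rayleigh_le_lambda1:
  assumes "symmetric_mat n A" and x: "x \<in> carrier_vec n"
  shows "x \<bullet> (A *\<^sub>v x) \<le> lambda1 A * (x \<bullet> x)"
proof -
  obtain Q \<mu> where "orthonormal_diagonalization n A Q \<mu>"
    using symmetric_mat_diagonalizable[OF assms(1)] by blast
  then interpret orthonormal_diagonalization n A Q \<mu> .
  show ?thesis
    unfolding quadratic_form_coord[OF x] scalar_prod_self_coord[OF x] sum_distrib_left
    by (intro sum_mono mult_right_mono) (auto simp: lambda1_ge)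
qed

lemma eigenvector_if_rayleigh_ge_lambda1:
  assumes "symmetric_mat n A" and x: "x \<in> carrier_vec n"
    and ge: "lambda1 A * (x \<bullet> x) \<le> x \<bullet> (A *\<^sub>v x)"
  shows "A *\<^sub>v x = lambda1 A \<cdot>\<^sub>v x"
proof -
  obtain Q \<mu> where "orthonormal_diagonalization n A Q \<mu>"
    using symmetric_mat_diagonalizable[OF assms(1)] by blast
  then interpret orthonormal_diagonalization n A Q \<mu> .
  have nonneg: "0 \<le> (lambda1 A - \<mu> i) * (coord x $ i)\<^sup>2" if "i < n" for i
    using lambda1_ge[OF that] by simp
  have "(\<Sum>i<n. (lambda1 A - \<mu> i) * (coord x $ i)\<^sup>2) = lambda1 A * (x \<bullet> x) - x \<bullet> (A *\<^sub>v x)"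
    by (simp add: quadratic_form_coord x scalar_prod_self_coord sum_distrib_left sum_subtractf
        left_diff_distrib)
  then have "(\<Sum>i<n. (lambda1 A - \<mu> i) * (coord x $ i)\<^sup>2) = 0"
    using ge nonneg by (intro order.antisym sum_nonneg) auto
  then have "(lambda1 A - \<mu> i) * (coord x $ i)\<^sup>2 = 0" if "i < n" for i
    using nonneg that by (subst (asm) sum_nonneg_eq_0_iff) auto
  then have scaled: "\<mu> i * coord x $ i = lambda1 A * coord x $ i" if "i < n" for i
    using that by fastforce
  show ?thesis
  proof (rule coord_inj)
    show "coord (A *\<^sub>v x) = coord (lambda1 A \<cdot>\<^sub>v x)"
    proof (rule eq_vecI)
      fix i assume "i < dim_vec (coord (lambda1 A \<cdot>\<^sub>v x))"
      then have i: "i < n" by simp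
      then show "coord (A *\<^sub>v x) $ i = coord (lambda1 A \<cdot>\<^sub>v x) $ i"
        using coord_mult_mat_vec[OF x i] scaled[OF i] x by (simp add: coord_smult)
    qed simp
  qed (use x A in simp_all)
qed

definition top_unit_eigenvector :: "nat \<Rightarrow> real mat \<Rightarrow> real Matrix.vec \<Rightarrow> bool" where
  "top_unit_eigenvector n A v \<longleftrightarrow>
     v \<in> carrier_vec n \<and> vnorm v = 1 \<and> A *\<^sub>v v = lambda1 A \<cdot>\<^sub>v v"

lemma quadratic_form_top_unit_eigenvector:
  "top_unit_eigenvector n A v \<Longrightarrow> v \<bullet> (A *\<^sub>v v) = lambda1 A"
  by (auto simp: top_unit_eigenvector_def vnorm_eq_1_iff)

lemma eigenvalue_lambda1:
  assumes "symmetric_mat n A" "0 < n"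
  shows "eigenvalue A (lambda1 A)"
proof -
  obtain Q \<mu> where "orthonormal_diagonalization n A Q \<mu>"
    using symmetric_mat_diagonalizable[OF assms(1)] by blast
  then interpret orthonormal_diagonalization n A Q \<mu> .
  obtain t where t: "t < n" "\<mu> t = lambda1 A"
    using lambda1_attained[OF assms(2)] .
  have "lambda1 A \<in># eigvals A"
    using t(1) by (simp add: eigvals_eq flip: t(2))
  moreover have "char_poly A \<noteq> 0"
    using degree_monic_char_poly[OF A] by auto
  ultimately show ?thesis
    by (simp add: eigenvalue_root_char_poly[OF A] eigvals_def)
qed

lemma top_unit_eigenvector_exists:
  assumes "symmetric_mat n A" "0 < n"
  obtains u where "top_unit_eigenvector n A u"
  using unit_eigenvector_exists[OF symmetric_mat_carrier[OF assms(1)] eigenvalue_lambda1[OF assms]]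
  unfolding top_unit_eigenvector_def by blast

lemma lambda1_le_spectral_radius:
  assumes "symmetric_mat n A" "0 < n"
  shows "lambda1 A \<le> spectral_radius (map_mat complex_of_real A)"
proof -
  note A = symmetric_mat_carrier[OF assms(1)]
  have "complex_of_real (lambda1 A) \<in> spectrum (map_mat complex_of_real A)"
    using of_real_hom.eigenvalue_hom[OF A eigenvalue_lambda1[OF assms]] by (simp add: spectrum_def)
  then have "cmod (complex_of_real (lambda1 A)) \<le> spectral_radius (map_mat complex_of_real A)"
    using A assms(2) by (intro spectral_radius_mem_max(2)[of _ n] imageI) auto
  then show ?thesis by simp
qed

lemma top_unit_eigenvector_v1:
  assumes A: "symmetric_mat n A" and n: "0 < n"
    and nonneg: "\<And>i j. i < n \<Longrightarrow> j < n \<Longrightarrow> 0 \<le> A $$ (i, j)"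
  shows "top_unit_eigenvector n A (v1 A)"
proof -
  note Ac = symmetric_mat_carrier[OF A]
  obtain x where x: "top_unit_eigenvector n A x"
    using top_unit_eigenvector_exists[OF A n] .
  then have xc: "x \<in> carrier_vec n" and xx: "x \<bullet> x = 1"
    by (auto simp: top_unit_eigenvector_def vnorm_eq_1_iff)
  define y where "y = Matrix.vec n (\<lambda>i. \<bar>x $ i\<bar>)"
  have y: "y \<in> carrier_vec n"
    by (simp add: y_def)
  have yy: "y \<bullet> y = 1"
    using xc xx by (simp add: scalar_prod_eq_sum y_def)
  have form: "z \<bullet> (A *\<^sub>v z) = (\<Sum>i<n. \<Sum>j<n. A $$ (i, j) * (z $ i * z $ j))"
    if "z \<in> carrier_vec n" for z
    using that Ac by (simp add: scalar_prod_eq_sum[of _ n] sum_distrib_left mult_ac)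
  \<comment> \<open>\<open>A\<close> being nonnegative, taking absolute values cannot decrease the form\<close>
  have "x \<bullet> (A *\<^sub>v x) \<le> y \<bullet> (A *\<^sub>v y)"
    unfolding form[OF xc] form[OF y]
    by (intro sum_mono mult_left_mono) (auto simp: y_def nonneg simp flip: abs_mult)
  then have "A *\<^sub>v y = lambda1 A \<cdot>\<^sub>v y"
    using quadratic_form_top_unit_eigenvector[OF x] yy
    by (intro eigenvector_if_rayleigh_ge_lambda1[OF A y]) simp
  then have "y \<in> carrier_vec (dim_row A) \<and> eigenvector A y (lambda1 A) \<and>
      vnorm y = 1 \<and> (\<forall>i < dim_row A. y $ i \<ge> 0)"
    using Ac y yy by (auto simp: eigenvector_def vnorm_eq_1_iff) (simp add: y_def)
  then have "v1 A \<in> carrier_vec (dim_row A) \<and> eigenvector A (v1 A) (lambda1 A) \<and>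
      vnorm (v1 A) = 1 \<and> (\<forall>i < dim_row A. v1 A $ i \<ge> 0)"
    unfolding v1_def by (rule someI)
  then show ?thesis
    using Ac by (auto simp: top_unit_eigenvector_def eigenvector_def)
qed

lemma lambda1_nonneg:
  assumes A: "symmetric_mat n A" and "i < n" "0 \<le> A $$ (i, i)"
  shows "0 \<le> lambda1 A"
  using rayleigh_le_lambda1[OF A, of "unit_vec n i"] symmetric_mat_carrier[OF A] assms(2,3) by simp

lemma quadratic_form_le_spectral_gap:
  assumes "symmetric_mat n A" and v: "top_unit_eigenvector n A v"
    and other: "\<And>e. e \<in># other_eigvals A \<Longrightarrow> e \<le> \<nu>" and gap: "\<nu> < lambda1 A"
    and u: "u \<in> carrier_vec n" "vnorm u = 1"
  shows "u \<bullet> (A *\<^sub>v u) \<le> lambda1 A * (u \<bullet> v)\<^sup>2 + \<nu> * (1 - (u \<bullet> v)\<^sup>2)"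
proof -
  obtain Q \<mu> where "orthonormal_diagonalization n A Q \<mu>"
    using symmetric_mat_diagonalizable[OF assms(1)] by blast
  then interpret orthonormal_diagonalization n A Q \<mu> .
  have vc: "v \<in> carrier_vec n" "v \<bullet> v = 1" and Av: "A *\<^sub>v v = lambda1 A \<cdot>\<^sub>v v"
    using v by (auto simp: top_unit_eigenvector_def vnorm_eq_1_iff)
  have "0 < n"
    using vc by (cases n) (auto simp: scalar_prod_def)
  then obtain t where t: "t < n" "\<mu> t = lambda1 A"
    and others: "other_eigvals A = image_mset \<mu> (mset_set ({..<n} - {t}))"
    by (rule lambda1_attained)
  let ?I = "{..<n} - {t}"
  have split: "(\<Sum>i<n. f i) = f t + sum f ?I" for f :: "nat \<Rightarrow> real"
    using t(1) by (intro sum.remove) auto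
  have le: "\<mu> i \<le> \<nu>" if "i \<in> ?I" for i
    using that by (intro other) (simp add: others)
  have zero: "coord v $ i = 0" if "i \<in> ?I" for i
    using le[OF that] gap that by (intro coord_eigenvector_eq_0[OF vc(1) Av]) auto
  have "(coord v $ t)\<^sup>2 = 1"
    using vc(2) zero by (simp add: scalar_prod_self_coord[OF vc(1)] split)
  moreover have "u \<bullet> v = coord u $ t * coord v $ t"
    using zero by (simp add: scalar_prod_coord[OF u(1) vc(1)] split)
  ultimately have uv: "(u \<bullet> v)\<^sup>2 = (coord u $ t)\<^sup>2"
    by (simp add: power_mult_distrib)
  have rest: "(\<Sum>i\<in>?I. (coord u $ i)\<^sup>2) = 1 - (u \<bullet> v)\<^sup>2"
    using u(2) unfolding vnorm_eq_1_iff scalar_prod_self_coord[OF u(1)] split uv by simp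
  have "(\<Sum>i\<in>?I. \<mu> i * (coord u $ i)\<^sup>2) \<le> (\<Sum>i\<in>?I. \<nu> * (coord u $ i)\<^sup>2)"
    by (intro sum_mono mult_right_mono le) auto
  then show ?thesis
    unfolding quadratic_form_coord[OF u(1)] split t(2) uv[symmetric] rest[symmetric]
    by (simp add: sum_distrib_left)
qed

definition numerical_radius_le :: "nat \<Rightarrow> real mat \<Rightarrow> real \<Rightarrow> bool" where
  "numerical_radius_le n X r \<longleftrightarrow>
     (\<forall>u \<in> carrier_vec n. vnorm u = 1 \<longrightarrow> \<bar>u \<bullet> (X *\<^sub>v u)\<bar> \<le> r)"

text \<open>
  A variant of the Davis--Kahan theorem: replacing \<open>v\<close> by \<open>u\<close> loses at least
  \<open>1 - (u, v)\<^sup>2\<close> times the spectral gap in the form of \<open>B\<close>, but gains in the form of \<open>A\<close>.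
\<close>

lemma top_unit_eigenvector_perturbation:
  assumes A: "symmetric_mat n A" and B: "symmetric_mat n B"
    and u: "top_unit_eigenvector n A u" and v: "top_unit_eigenvector n B v"
    and other: "\<And>e. e \<in># other_eigvals B \<Longrightarrow> e \<le> \<nu>" and gap: "\<nu> < lambda1 B"
    and close: "numerical_radius_le n (A - B) r"
  shows "(1 - (u \<bullet> v)\<^sup>2) * (lambda1 B - \<nu>) \<le> 2 * r"
proof -
  have uc: "u \<in> carrier_vec n" "vnorm u = 1" and vc: "v \<in> carrier_vec n" "vnorm v = 1"
    using u v by (auto simp: top_unit_eigenvector_def)
  have form_diff: "\<bar>x \<bullet> (A *\<^sub>v x) - x \<bullet> (B *\<^sub>v x)\<bar> \<le> r"
    if "x \<in> carrier_vec n" "vnorm x = 1" for x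
    using close that symmetric_mat_carrier[OF A] symmetric_mat_carrier[OF B]
    by (simp add: numerical_radius_le_def minus_mult_distrib_mat_vec[of _ n n]
        scalar_prod_minus_distrib[of _ n])
  have "lambda1 B = v \<bullet> (B *\<^sub>v v)"
    using quadratic_form_top_unit_eigenvector[OF v] by simp
  also have "\<dots> \<le> v \<bullet> (A *\<^sub>v v) + r"
    using form_diff[OF vc] by simp
  also have "v \<bullet> (A *\<^sub>v v) \<le> u \<bullet> (A *\<^sub>v u)"
    using rayleigh_le_lambda1[OF A vc(1)] vc(2) quadratic_form_top_unit_eigenvector[OF u]
    by (simp add: vnorm_eq_1_iff)
  also have "u \<bullet> (A *\<^sub>v u) \<le> u \<bullet> (B *\<^sub>v u) + r"
    using form_diff[OF uc] by simp
  also have "u \<bullet> (B *\<^sub>v u) \<le> lambda1 B * (u \<bullet> v)\<^sup>2 + \<nu> * (1 - (u \<bullet> v)\<^sup>2)"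
    by (rule quadratic_form_le_spectral_gap[OF B v other gap uc])
  finally show ?thesis
    by (simp add: algebra_simps)
qed

section \<open>Traces of powers\<close>

definition mat_trace :: "'a :: comm_monoid_add mat \<Rightarrow> 'a" where
  "mat_trace A = (\<Sum>i<dim_row A. A $$ (i, i))"

lemma mat_trace_mult_commute:
  fixes A B :: "'a :: comm_semiring_0 mat"
  assumes "A \<in> carrier_mat n m" "B \<in> carrier_mat m n"
  shows "mat_trace (A * B) = mat_trace (B * A)"
proof -
  have "mat_trace (A * B) = (\<Sum>i<n. \<Sum>j<m. A $$ (i, j) * B $$ (j, i))"
    using assms by (simp add: mat_trace_def scalar_prod_def lessThan_atLeast0)
  also have "\<dots> = (\<Sum>j<m. \<Sum>i<n. B $$ (j, i) * A $$ (i, j))"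
    by (subst sum.swap) (simp add: mult.commute)
  also have "\<dots> = mat_trace (B * A)"
    using assms by (simp add: mat_trace_def scalar_prod_def lessThan_atLeast0)
  finally show ?thesis .
qed

lemma mat_trace_similar:
  fixes A :: "'a :: comm_semiring_1 mat"
  assumes "A \<in> carrier_mat n n" "similar_mat_wit A B P Q"
  shows "mat_trace A = mat_trace B"
proof -
  note wit = similar_mat_witD2[OF assms]
  have "mat_trace A = mat_trace (P * (B * Q))"
    using wit by simp
  also have "\<dots> = mat_trace (B * Q * P)"
    using wit by (intro mat_trace_mult_commute[of _ n n]) auto
  also have "B * Q * P = B"
    using wit by (simp add: assoc_mult_mat[of _ n n _ n _ n])
  finally show ?thesis .
qed

lemma mat_diag_pow: "mat_diag n f ^\<^sub>m k = mat_diag n (\<lambda>i. f i ^ k)"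
  by (induction k) (simp_all add: carrier_matD(1)[OF mat_diag_dim] power_Suc2 del: power_Suc)

lemma (in orthonormal_diagonalization) mat_trace_pow: "mat_trace (A ^\<^sub>m k) = (\<Sum>i<n. \<mu> i ^ k)"
proof -
  have "mat_trace (A ^\<^sub>m k) = mat_trace (mat_diag n \<mu> ^\<^sub>m k)"
    using similar_mat_wit_pow[OF similar_mat_diag] A by (intro mat_trace_similar[of _ n]) auto
  then show ?thesis
    by (simp add: mat_diag_pow) (simp add: mat_trace_def mat_diag_def)
qed

lemma mat_trace_even_pow_nonneg:
  fixes X :: "real mat"
  assumes "symmetric_mat n X"
  shows "0 \<le> mat_trace (X ^\<^sub>m (2 * k))"
proof -
  obtain Q \<mu> where "orthonormal_diagonalization n X Q \<mu>"
    using symmetric_mat_diagonalizable[OF assms] by blast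
  then interpret orthonormal_diagonalization n X Q \<mu> .
  show ?thesis
    unfolding mat_trace_pow by (intro sum_nonneg) (simp add: power_mult)
qed

lemma quadratic_form_even_pow_le_trace:
  assumes "symmetric_mat n X" and u: "u \<in> carrier_vec n" "vnorm u = 1"
  shows "(u \<bullet> (X *\<^sub>v u)) ^ (2 * k) \<le> mat_trace (X ^\<^sub>m (2 * k))"
proof -
  obtain Q \<mu> where "orthonormal_diagonalization n X Q \<mu>"
    using symmetric_mat_diagonalizable[OF assms(1)] by blast
  then interpret orthonormal_diagonalization n X Q \<mu> .
  have uu: "(\<Sum>i<n. (coord u $ i)\<^sup>2) = 1"
    using u by (simp add: vnorm_eq_1_iff scalar_prod_self_coord)
  then have "0 < n"
    by (cases n) auto
  define M where "M = Max ((\<lambda>i. \<bar>\<mu> i\<bar>) ` {..<n})"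
  have "M \<in> (\<lambda>i. \<bar>\<mu> i\<bar>) ` {..<n}"
    using \<open>0 < n\<close> unfolding M_def by (intro Max_in) auto
  then obtain t where t: "t < n" "M = \<bar>\<mu> t\<bar>"
    by auto
  have "\<bar>u \<bullet> (X *\<^sub>v u)\<bar> \<le> (\<Sum>i<n. \<bar>\<mu> i\<bar> * (coord u $ i)\<^sup>2)"
    unfolding quadratic_form_coord[OF u(1)] by (rule order_trans[OF sum_abs]) (simp add: abs_mult)
  also have "\<dots> \<le> (\<Sum>i<n. M * (coord u $ i)\<^sup>2)"
    by (intro sum_mono mult_right_mono) (auto simp: M_def)
  also have "\<dots> = \<bar>\<mu> t\<bar>"
    using uu t(2) by (simp flip: sum_distrib_left)
  finally have "(u \<bullet> (X *\<^sub>v u)) ^ (2 * k) \<le> \<mu> t ^ (2 * k)"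
    by (simp add: power_mult power_mono abs_le_square_iff)
  also have "\<dots> \<le> (\<Sum>i<n. \<mu> i ^ (2 * k))"
    using t(1) by (intro member_le_sum) (auto simp: power_mult)
  finally show ?thesis
    by (simp add: mat_trace_pow)
qed

section \<open>Walks with few distinct edges\<close>

definition edge :: "nat \<Rightarrow> nat \<Rightarrow> nat \<times> nat" where
  "edge i j = (min i j, max i j)"

definition edges :: "nat \<Rightarrow> (nat \<times> nat) set" where
  "edges n = {(i, j). i \<le> j \<and> j < n}"

lemma edge_commute: "edge i j = edge j i"
  by (simp add: edge_def min.commute max.commute)

lemma edge_in_edges: "i < n \<Longrightarrow> j < n \<Longrightarrow> edge i j \<in> edges n"
  by (auto simp: edge_def edges_def)

lemma edge_eq_iff: "edge i l = edge j l \<longleftrightarrow> i = j"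
  by (auto simp: edge_def min_def max_def)

lemma finite_edges: "finite (edges n)"
  by (rule finite_subset[of _ "{..<n} \<times> {..<n}"]) (auto simp: edges_def)

definition edge_mat :: "nat \<Rightarrow> (nat \<times> nat \<Rightarrow> 'a) \<Rightarrow> 'a mat" where
  "edge_mat n x = Matrix.mat n n (\<lambda>(i, j). x (edge i j))"

lemma edge_mat_carrier: "edge_mat n x \<in> carrier_mat n n"
  by (simp add: edge_mat_def)

lemma symmetric_edge_mat: "symmetric_mat n (edge_mat n x)"
  by (rule symmetric_matI) (simp_all add: edge_mat_def edge_commute)

definition walks :: "nat \<Rightarrow> nat \<Rightarrow> nat \<Rightarrow> nat \<Rightarrow> nat list set" where
  "walks n m i j = {w. set w \<subseteq> {..<n} \<and> length w = Suc m \<and> hd w = i \<and> last w = j}"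

fun walk_edges :: "nat list \<Rightarrow> (nat \<times> nat) list" where
  "walk_edges (i # j # w) = edge i j # walk_edges (j # w)"
| "walk_edges _ = []"

lemma finite_walks: "finite (walks n m i j)"
  by (rule finite_subset[OF _ finite_lists_length_eq[of "{..<n}" "Suc m"]]) (auto simp: walks_def)

lemma walks_0: "i < n \<Longrightarrow> walks n 0 i j = (if i = j then {[i]} else {})"
  by (auto simp: walks_def length_Suc_conv)

lemma walks_Suc: "i < n \<Longrightarrow> walks n (Suc m) i j = (\<Union>l<n. (#) i ` walks n m l j)"
  by (auto simp: walks_def length_Suc_conv image_iff)

lemma sum_walks_Suc:
  assumes "i < n"
  shows "sum f (walks n (Suc m) i j) = (\<Sum>l<n. \<Sum>w\<in>walks n m l j. f (i # w))"
proof -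
  have "sum f (walks n (Suc m) i j) = (\<Sum>l<n. sum f ((#) i ` walks n m l j))"
    unfolding walks_Suc[OF assms]
    using finite_walks by (intro sum.UNION_disjoint) (auto simp: walks_def)
  then show ?thesis
    by (simp add: sum.reindex)
qed

lemma walk_edges_Cons: "w \<in> walks n m l j \<Longrightarrow> walk_edges (i # w) = edge i l # walk_edges w"
  by (cases w) (auto simp: walks_def)

lemma length_walk_edges: "w \<in> walks n m i j \<Longrightarrow> length (walk_edges w) = m"
proof -
  have "length (walk_edges w) = length w - 1" for w
    by (induction w rule: walk_edges.induct) auto
  then show "w \<in> walks n m i j \<Longrightarrow> length (walk_edges w) = m"
    by (simp add: walks_def)
qed

lemma set_walk_edges: "w \<in> walks n m i j \<Longrightarrow> set (walk_edges w) \<subseteq> edges n"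
proof -
  have "set w \<subseteq> {..<n} \<Longrightarrow> set (walk_edges w) \<subseteq> edges n" for w
    by (induction w rule: walk_edges.induct) (auto simp: edge_in_edges)
  then show "w \<in> walks n m i j \<Longrightarrow> set (walk_edges w) \<subseteq> edges n"
    by (simp add: walks_def)
qed

lemma edge_mat_pow_eq_sum_walks:
  fixes x :: "nat \<times> nat \<Rightarrow> 'a :: comm_semiring_1"
  assumes "i < n" "j < n"
  shows "(edge_mat n x ^\<^sub>m m) $$ (j, i) = (\<Sum>w\<in>walks n m i j. \<Prod>e\<leftarrow>walk_edges w. x e)"
  using assms(1)
proof (induction m arbitrary: i)
  case 0
  then show ?case
    using assms(2) by (simp add: walks_0 edge_mat_def)
next
  case (Suc m)
  have "(edge_mat n x ^\<^sub>m Suc m) $$ (j, i) =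
      (\<Sum>l<n. (edge_mat n x ^\<^sub>m m) $$ (j, l) * edge_mat n x $$ (l, i))"
    using Suc.prems assms(2) pow_carrier_mat[OF edge_mat_carrier, of n x m]
    by (simp add: scalar_prod_def lessThan_atLeast0 edge_mat_def)
  also have "\<dots> = (\<Sum>l<n. \<Sum>w\<in>walks n m l j. x (edge i l) * (\<Prod>e\<leftarrow>walk_edges w. x e))"
    using Suc by (simp add: edge_mat_def edge_commute sum_distrib_left mult.commute)
  also have "\<dots> = (\<Sum>w\<in>walks n (Suc m) i j. \<Prod>e\<leftarrow>walk_edges w. x e)"
    using Suc.prems by (simp add: sum_walks_Suc walk_edges_Cons)
  finally show ?case .
qed

lemma mat_trace_edge_mat_pow:
  fixes x :: "nat \<times> nat \<Rightarrow> 'a :: comm_semiring_1"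
  shows "mat_trace (edge_mat n x ^\<^sub>m m) = (\<Sum>i<n. \<Sum>w\<in>walks n m i i. \<Prod>e\<leftarrow>walk_edges w. x e)"
  by (simp add: mat_trace_def edge_mat_pow_eq_sum_walks carrier_matD(1)[OF edge_mat_carrier])

definition few_edges_weight :: "nat \<Rightarrow> ('a \<Rightarrow> real) \<Rightarrow> 'a list \<Rightarrow> real" where
  "few_edges_weight k q es = (if card (set es) \<le> k then prod q (set es) else 0)"

lemma few_edges_weight_nonneg:
  assumes "\<And>e. e \<in> set es \<Longrightarrow> 0 \<le> q e"
  shows "0 \<le> few_edges_weight k q es"
  using assms by (auto simp: few_edges_weight_def intro: prod_nonneg)

lemma few_edges_weight_Cons_le:
  assumes "0 \<le> q e" "\<And>e. e \<in> set es \<Longrightarrow> 0 \<le> q e"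
  shows "few_edges_weight k q (e # es) \<le> (q e + of_bool (e \<in> set es)) * few_edges_weight k q es"
proof -
  have "0 \<le> prod q (set es)"
    using assms(2) by (intro prod_nonneg) auto
  then show ?thesis
    using assms(1)
    by (cases "e \<in> set es") (auto simp: few_edges_weight_def insert_absorb distrib_right)
qed

lemma few_edges_weight_le_rescaled:
  assumes "1 \<le> \<theta>" "\<And>e. e \<in> set es \<Longrightarrow> 0 \<le> q e"
  shows "few_edges_weight k q es \<le> \<theta> ^ k * few_edges_weight k (\<lambda>e. q e / \<theta>) es"
proof -
  have "prod q (set es) \<le> \<theta> ^ k * (prod q (set es) / \<theta> ^ card (set es))" if "card (set es) \<le> k"
  proof -
    have "prod q (set es) * \<theta> ^ card (set es) \<le> prod q (set es) * \<theta> ^ k"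
      using assms that by (intro mult_left_mono power_increasing prod_nonneg) auto
    then show ?thesis
      using assms(1) by (simp add: field_simps)
  qed
  then show ?thesis
    by (simp add: few_edges_weight_def prod_dividef)
qed

text \<open>
  Prepending a vertex to a walk either adds a new edge, which costs a row sum of \<open>q\<close>, or repeats
  one of the at most \<open>k\<close> edges already present, each of which determines the new vertex.
\<close>

lemma sum_few_edges_weight_Cons_le:
  assumes q: "\<And>e. e \<in> edges n \<Longrightarrow> 0 \<le> q e" and s: "(\<Sum>i<n. q (edge i l)) \<le> s"
    and l: "l < n" and es: "set es \<subseteq> edges n"
  shows "(\<Sum>i<n. few_edges_weight k q (edge i l # es)) \<le> (s + real k) * few_edges_weight k q es"
proof (cases "card (set es) \<le> k")
  case True
  have "inj_on (\<lambda>i. edge i l) {i. i < n \<and> edge i l \<in> set es}"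
    by (auto simp: inj_on_def edge_eq_iff)
  then have "card {i. i < n \<and> edge i l \<in> set es} \<le> card (set es)"
    by (intro card_inj_on_le) auto
  then have repeats: "(\<Sum>i<n. of_bool (edge i l \<in> set es) :: real) \<le> real k"
    using True by (simp add: of_bool_def sum.If_cases Int_def)
  have "(\<Sum>i<n. few_edges_weight k q (edge i l # es))
      \<le> (\<Sum>i<n. (q (edge i l) + of_bool (edge i l \<in> set es)) * few_edges_weight k q es)"
    using l es by (intro sum_mono few_edges_weight_Cons_le q) (auto simp: edge_in_edges)
  also have "\<dots> = ((\<Sum>i<n. q (edge i l)) + (\<Sum>i<n. of_bool (edge i l \<in> set es)))
      * few_edges_weight k q es"
    by (simp only: sum.distrib flip: sum_distrib_right)
  also have "\<dots> \<le> (s + real k) * few_edges_weight k q es"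
    using es by (intro mult_right_mono add_mono s repeats few_edges_weight_nonneg q) auto
  finally show ?thesis .
next
  case False
  have "card (set es) \<le> card (set (e # es))" for e
    by (intro card_mono) auto
  then have "\<not> card (set (e # es)) \<le> k" for e
    using False order_trans by blast
  then show ?thesis
    using False by (simp add: few_edges_weight_def)
qed

lemma sum_walks_few_edges_weight_le:
  assumes q: "\<And>e. e \<in> edges n \<Longrightarrow> 0 \<le> q e"
    and s: "\<And>l. l < n \<Longrightarrow> (\<Sum>i<n. q (edge i l)) \<le> s" and "0 \<le> s" and j: "j < n"
  shows "(\<Sum>i<n. \<Sum>w\<in>walks n m i j. few_edges_weight k q (walk_edges w)) \<le> (s + real k) ^ m"
proof (induction m)
  case 0
  have "(\<Sum>i<n. \<Sum>w\<in>walks n 0 i j. few_edges_weight k q (walk_edges w)) = (\<Sum>i<n. of_bool (i = j))"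
    by (intro sum.cong) (auto simp: walks_0 few_edges_weight_def)
  then show ?case
    using j by (simp add: of_bool_def)
next
  case (Suc m)
  let ?g = "\<lambda>w. few_edges_weight k q (walk_edges w)"
  have "(\<Sum>i<n. \<Sum>w\<in>walks n (Suc m) i j. ?g w) = (\<Sum>i<n. \<Sum>l<n. \<Sum>w\<in>walks n m l j. ?g (i # w))"
    by (simp add: sum_walks_Suc)
  also have "\<dots> = (\<Sum>l<n. \<Sum>w\<in>walks n m l j. \<Sum>i<n. few_edges_weight k q (edge i l # walk_edges w))"
    by (subst sum.swap) (simp add: sum.swap[of _ "{..<n}" "walks n m _ j"] walk_edges_Cons)
  also have "\<dots> \<le> (\<Sum>l<n. \<Sum>w\<in>walks n m l j. (s + real k) * ?g w)"
    using set_walk_edges by (intro sum_mono sum_few_edges_weight_Cons_le q s) auto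
  also have "\<dots> = (s + real k) * (\<Sum>l<n. \<Sum>w\<in>walks n m l j. ?g w)"
    by (simp add: sum_distrib_left)
  also have "\<dots> \<le> (s + real k) * (s + real k) ^ m"
    using Suc.IH \<open>0 \<le> s\<close> by (intro mult_left_mono) auto
  finally show ?case by simp
qed

lemma sum_closed_walks_few_edges_weight_le:
  assumes p: "\<And>e. e \<in> edges n \<Longrightarrow> 0 \<le> p e"
    and D: "\<And>l. l < n \<Longrightarrow> (\<Sum>i<n. p (edge i l)) \<le> D"
    and k: "0 < k" "real k \<le> D"
  shows "(\<Sum>i<n. \<Sum>w\<in>walks n (2 * k) i i. few_edges_weight k p (walk_edges w))
           \<le> real n * (4 * D * real k) ^ k"
proof -
  \<comment> \<open>dividing the weights by \<open>\<theta>\<close> balances the two summands of \<open>s + real k\<close> in the preceding bound\<close>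
  define \<theta> where "\<theta> = D / real k"
  have \<theta>: "1 \<le> \<theta>" "D / \<theta> = real k"
    using k by (simp_all add: \<theta>_def)
  have nonneg: "0 \<le> few_edges_weight k p (walk_edges w)" if "w \<in> walks n m i j" for w m i j
    using set_walk_edges[OF that] by (intro few_edges_weight_nonneg p) auto
  have "(\<Sum>i<n. \<Sum>w\<in>walks n (2 * k) i i. few_edges_weight k p (walk_edges w))
      \<le> (\<Sum>j<n. \<Sum>i<n. \<Sum>w\<in>walks n (2 * k) i j. few_edges_weight k p (walk_edges w))"
  proof (rule sum_mono)
    fix j assume "j \<in> {..<n}"
    then show "(\<Sum>w\<in>walks n (2 * k) j j. few_edges_weight k p (walk_edges w))
        \<le> (\<Sum>i<n. \<Sum>w\<in>walks n (2 * k) i j. few_edges_weight k p (walk_edges w))"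
      by (intro member_le_sum[of j "{..<n}"] sum_nonneg nonneg) auto
  qed
  also have "\<dots> \<le> (\<Sum>j<n. \<Sum>i<n. \<Sum>w\<in>walks n (2 * k) i j.
      \<theta> ^ k * few_edges_weight k (\<lambda>e. p e / \<theta>) (walk_edges w))"
    using set_walk_edges by (intro sum_mono few_edges_weight_le_rescaled p \<theta>(1)) blast
  also have "\<dots> = (\<Sum>j<n. \<theta> ^ k *
      (\<Sum>i<n. \<Sum>w\<in>walks n (2 * k) i j. few_edges_weight k (\<lambda>e. p e / \<theta>) (walk_edges w)))"
    by (simp add: sum_distrib_left)
  also have "\<dots> \<le> (\<Sum>j<n. \<theta> ^ k * (real k + real k) ^ (2 * k))"
  proof (intro sum_mono mult_left_mono sum_walks_few_edges_weight_le)
    fix l assume "l < n"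
    then show "(\<Sum>i<n. p (edge i l) / \<theta>) \<le> real k"
      using D \<theta> by (simp add: divide_right_mono flip: sum_divide_distrib \<theta>(2))
  qed (use p \<theta> in auto)
  also have "\<dots> = real n * (\<theta> * (2 * real k)\<^sup>2) ^ k"
    by (simp add: power_mult power_mult_distrib)
  also have "\<theta> * (2 * real k)\<^sup>2 = 4 * D * real k"
    using k by (simp add: \<theta>_def power2_eq_square)
  finally show ?thesis .
qed

section \<open>Moments of independent centred Bernoulli variables\<close>

lemma expectation_prod_Pi_pmf_finite_support:
  fixes f :: "'a \<Rightarrow> 'b \<Rightarrow> real"
  assumes I: "finite I" and J: "J \<subseteq> I" and fin: "\<And>i. i \<in> I \<Longrightarrow> finite (set_pmf (p i))"
  shows "measure_pmf.expectation (Pi_pmf I d p) (\<lambda>y. \<Prod>i\<in>J. f i (y i)) =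
           (\<Prod>i\<in>J. measure_pmf.expectation (p i) (f i))"
proof -
  let ?P = "Pi_pmf I d p"
  have finP: "finite (set_pmf ?P)"
    using I fin by (subst set_Pi_pmf) auto
  have "prob_space.indep_vars ?P (\<lambda>_. borel) (\<lambda>i y. f i (y i)) J"
    using prob_space.indep_vars_compose2[OF measure_pmf.prob_space_axioms
        prob_space.indep_vars_subset[OF measure_pmf.prob_space_axioms indep_vars_Pi_pmf[OF I] J],
        where Y = f and N = "\<lambda>_. borel"]
    by simp
  then have "measure_pmf.expectation ?P (\<lambda>y. \<Prod>i\<in>J. f i (y i)) =
      (\<Prod>i\<in>J. measure_pmf.expectation ?P (\<lambda>y. f i (y i)))"
    using finite_subset[OF J I] integrable_measure_pmf_finite[OF finP]
    by (intro prob_space.indep_vars_lebesgue_integral[OF measure_pmf.prob_space_axioms])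
  also have "\<dots> = (\<Prod>i\<in>J. measure_pmf.expectation (map_pmf (\<lambda>y. y i) ?P) (f i))"
    by simp
  also have "\<dots> = (\<Prod>i\<in>J. measure_pmf.expectation (p i) (f i))"
    using J by (intro prod.cong refl, subst Pi_pmf_component[OF I]) auto
  finally show ?thesis .
qed

definition bernoulli_centred_moment :: "real \<Rightarrow> nat \<Rightarrow> real" where
  "bernoulli_centred_moment p c =
     measure_pmf.expectation (bernoulli_pmf p) (\<lambda>v. (of_bool v - p) ^ c)"

lemma bernoulli_centred_moment_eq:
  assumes "0 \<le> p" "p \<le> 1"
  shows "bernoulli_centred_moment p c = p * (1 - p) ^ c + (1 - p) * (- p) ^ c"
  using assms by (simp add: bernoulli_centred_moment_def mult.commute)

lemma abs_bernoulli_centred_moment_le: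
  assumes p: "0 \<le> p" "p \<le> 1" and "0 < c"
  shows "\<bar>bernoulli_centred_moment p c\<bar> \<le> p"
proof -
  obtain d where c: "c = Suc d"
    using \<open>0 < c\<close> gr0_implies_Suc by blast
  have "bernoulli_centred_moment p c = p * (1 - p) * ((1 - p) ^ d - (- p) ^ d)"
    by (simp add: bernoulli_centred_moment_eq[OF p] c algebra_simps)
  moreover have "\<bar>(1 - p) ^ d - (- p) ^ d\<bar> \<le> 1"
  proof (cases d)
    case (Suc d')
    have "\<bar>(- p) ^ d\<bar> = p ^ d"
      using p by (simp add: power_abs)
    moreover have "(1 - p) ^ d \<le> 1 - p" "p ^ d \<le> p" "0 \<le> (1 - p) ^ d"
      using p power_decreasing[of 1 d "1 - p"] power_decreasing[of 1 d p] by (simp_all add: Suc)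
    ultimately show ?thesis by linarith
  qed simp
  ultimately have "\<bar>bernoulli_centred_moment p c\<bar> \<le> p * (1 - p)"
    using p by (simp add: abs_mult mult_left_le)
  also have "\<dots> \<le> p"
    using p by (simp add: mult_left_le)
  finally show ?thesis .
qed

lemma expectation_centred_prod_eq:
  fixes p :: "'a \<Rightarrow> real"
  assumes "finite I" "set es \<subseteq> I"
  shows "measure_pmf.expectation (Pi_pmf I False (\<lambda>e. bernoulli_pmf (p e)))
           (\<lambda>E. \<Prod>e\<leftarrow>es. of_bool (E e) - p e)
         = (\<Prod>e\<in>set es. bernoulli_centred_moment (p e) (count_list es e))"
proof -
  have "(\<Prod>e\<leftarrow>es. of_bool (E e) - p e) = (\<Prod>e\<in>set es. (of_bool (E e) - p e) ^ count_list es e)" for E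
    using image_prod_mset_multiplicity[of "\<lambda>e. of_bool (E e) - p e" "mset es"]
    by (simp add: prod_mset_prod_list count_mset flip: mset_map)
  then show ?thesis
    using expectation_prod_Pi_pmf_finite_support[OF assms,
        of "\<lambda>e. bernoulli_pmf (p e)" False "\<lambda>e v. (of_bool v - p e) ^ count_list es e"]
    by (simp add: bernoulli_centred_moment_def)
qed

text \<open>A factor that occurs only once has mean zero and is independent of the others.\<close>

lemma abs_expectation_centred_prod_le:
  fixes p :: "'a \<Rightarrow> real"
  assumes I: "finite I" and p: "\<And>e. e \<in> I \<Longrightarrow> 0 \<le> p e \<and> p e \<le> 1"
    and es: "set es \<subseteq> I" "length es = 2 * k"
  shows "\<bar>measure_pmf.expectation (Pi_pmf I False (\<lambda>e. bernoulli_pmf (p e)))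
            (\<lambda>E. \<Prod>e\<leftarrow>es. of_bool (E e) - p e)\<bar> \<le> few_edges_weight k p es"
proof (cases "card (set es) \<le> k")
  case True
  have "(\<Prod>e\<in>set es. \<bar>bernoulli_centred_moment (p e) (count_list es e)\<bar>) \<le> prod p (set es)"
    using p es(1) count_list_0_iff[of es]
    by (intro prod_mono conjI abs_bernoulli_centred_moment_le) (auto intro!: gr0I)
  then show ?thesis
    using True by (simp add: expectation_centred_prod_eq[OF I es(1)] few_edges_weight_def abs_prod)
next
  case False
  have "\<exists>e\<in>set es. count_list es e < 2"
  proof (rule ccontr)
    assume "\<not> ?thesis"
    then have "(\<Sum>e\<in>set es. 2) \<le> (\<Sum>e\<in>set es. count_list es e)"
      by (intro sum_mono) auto
    then show False
      using False es(2) by (simp add: sum_count_set)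
  qed
  then obtain e where e: "e \<in> set es" "count_list es e = 1"
    by (metis One_nat_def count_list_0_iff less_2_cases)
  then have "bernoulli_centred_moment (p e) (count_list es e) = 0"
    using p[of e] es(1) by (subst bernoulli_centred_moment_eq) auto
  then have "(\<Prod>e\<in>set es. bernoulli_centred_moment (p e) (count_list es e)) = 0"
    using e(1) by (intro prod_zero) auto
  then show ?thesis
    using False by (simp add: expectation_centred_prod_eq[OF I es(1)] few_edges_weight_def)
qed

section \<open>The moment method\<close>

lemma trace_bound_le_radius_power:
  fixes d L \<delta> N :: real
  assumes N: "N \<le> \<delta> * exp L" and L: "0 \<le> L" "L \<le> real k" "real k \<le> 3 * L"
    and "0 \<le> d" "0 \<le> \<delta>"
  shows "N * (4 * (7 * d) * real k) ^ k \<le> \<delta> * (16 * sqrt (d * L)) ^ (2 * k)"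
proof -
  have "N \<le> \<delta> * exp (real k)"
    using N L \<open>0 \<le> \<delta>\<close> by (meson exp_le_cancel_iff mult_left_mono order_trans)
  then have "N * (4 * (7 * d) * real k) ^ k \<le> (\<delta> * exp (real k)) * (4 * (7 * d) * (3 * L)) ^ k"
    using L \<open>0 \<le> d\<close> \<open>0 \<le> \<delta>\<close> by (intro mult_mono power_mono mult_left_mono) auto
  also have "\<dots> = \<delta> * (84 * exp 1 * (d * L)) ^ k"
    by (simp add: power_mult_distrib mult_ac flip: exp_of_nat_mult)
  also have "\<dots> \<le> \<delta> * (256 * (d * L)) ^ k"
    using exp_le L \<open>0 \<le> d\<close> \<open>0 \<le> \<delta>\<close>
    by (intro mult_left_mono power_mono mult_right_mono) auto
  also have "\<dots> = \<delta> * (16 * sqrt (d * L)) ^ (2 * k)"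
    using L \<open>0 \<le> d\<close> by (simp add: power_mult power_mult_distrib)
  finally show ?thesis .
qed

locale random_edges =
  fixes n :: nat and p :: "nat \<times> nat \<Rightarrow> real"
  assumes prob: "\<And>e. e \<in> edges n \<Longrightarrow> 0 \<le> p e \<and> p e \<le> 1"
begin

definition edge_pmf :: "(nat \<times> nat \<Rightarrow> bool) pmf" where
  "edge_pmf = Pi_pmf (edges n) False (\<lambda>e. bernoulli_pmf (p e))"

definition noise :: "(nat \<times> nat \<Rightarrow> bool) \<Rightarrow> real mat" where
  "noise E = edge_mat n (\<lambda>e. of_bool (E e) - p e)"

lemma integrable_edge_pmf: "integrable edge_pmf (f :: _ \<Rightarrow> real)"
  unfolding edge_pmf_def
  by (intro integrable_measure_pmf_finite) (simp add: set_Pi_pmf finite_edges finite_PiE_dflt)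

lemma expectation_trace_noise_le:
  assumes D: "\<And>l. l < n \<Longrightarrow> (\<Sum>i<n. p (edge i l)) \<le> D" and k: "0 < k" "real k \<le> D"
  shows "measure_pmf.expectation edge_pmf (\<lambda>E. mat_trace (noise E ^\<^sub>m (2 * k)))
         \<le> real n * (4 * D * real k) ^ k"
proof -
  have "measure_pmf.expectation edge_pmf (\<lambda>E. mat_trace (noise E ^\<^sub>m (2 * k))) =
      (\<Sum>i<n. \<Sum>w\<in>walks n (2 * k) i i.
        measure_pmf.expectation edge_pmf (\<lambda>E. \<Prod>e\<leftarrow>walk_edges w. of_bool (E e) - p e))"
    by (simp only: noise_def mat_trace_edge_mat_pow
        Bochner_Integration.integral_sum[OF integrable_edge_pmf])
  also have "\<dots> \<le> (\<Sum>i<n. \<Sum>w\<in>walks n (2 * k) i i. few_edges_weight k p (walk_edges w))"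
  proof (intro sum_mono)
    fix i w assume w: "w \<in> walks n (2 * k) i i"
    show "measure_pmf.expectation edge_pmf (\<lambda>E. \<Prod>e\<leftarrow>walk_edges w. of_bool (E e) - p e)
        \<le> few_edges_weight k p (walk_edges w)"
      unfolding edge_pmf_def
      by (rule abs_le_D1, rule abs_expectation_centred_prod_le[OF finite_edges prob
            set_walk_edges[OF w] length_walk_edges[OF w]])
  qed
  also have "\<dots> \<le> real n * (4 * D * real k) ^ k"
    using prob by (intro sum_closed_walks_few_edges_weight_le D k) auto
  finally show ?thesis .
qed

lemma prob_numerical_radius_noise_ge:
  assumes r: "0 < r"
  shows "1 - measure_pmf.expectation edge_pmf (\<lambda>E. mat_trace (noise E ^\<^sub>m (2 * k))) / r ^ (2 * k)
         \<le> measure_pmf.prob edge_pmf {E. numerical_radius_le n (noise E) r}"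
proof -
  let ?T = "\<lambda>E. mat_trace (noise E ^\<^sub>m (2 * k))"
  let ?large = "{E. r ^ (2 * k) \<le> ?T E}"
  have form_le: "(u \<bullet> (noise E *\<^sub>v u)) ^ (2 * k) \<le> ?T E"
    if "u \<in> carrier_vec n" "vnorm u = 1" for u E
    unfolding noise_def by (rule quadratic_form_even_pow_le_trace[OF symmetric_edge_mat that])
  have "0 \<le> ?T E" for E
    unfolding noise_def by (rule mat_trace_even_pow_nonneg[OF symmetric_edge_mat])
  then have "measure_pmf.prob edge_pmf ?large \<le> measure_pmf.expectation edge_pmf ?T / r ^ (2 * k)"
    using integral_Markov_inequality_measure[OF integrable_edge_pmf, of UNIV ?T "r ^ (2 * k)"] r
    by simp
  then have "1 - measure_pmf.expectation edge_pmf ?T / r ^ (2 * k)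
      \<le> measure_pmf.prob edge_pmf (- ?large)"
    using measure_pmf.prob_compl[of ?large edge_pmf] by (simp add: Compl_eq_Diff_UNIV)
  also have "\<dots> \<le> measure_pmf.prob edge_pmf {E. numerical_radius_le n (noise E) r}"
  proof (intro measure_pmf.finite_measure_mono subsetI CollectI)
    fix E assume E: "E \<in> - ?large"
    have "\<bar>u \<bullet> (noise E *\<^sub>v u)\<bar> \<le> r" if u: "u \<in> carrier_vec n" "vnorm u = 1" for u
    proof -
      have "\<bar>u \<bullet> (noise E *\<^sub>v u)\<bar> ^ (2 * k) < r ^ (2 * k)"
        using form_le[OF u, of E] E by (simp add: power_even_abs)
      then show ?thesis
        using power_less_imp_less_base[of _ "2 * k" r] r by fastforce
    qed
    then show "numerical_radius_le n (noise E) r"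
      by (simp add: numerical_radius_le_def)
  qed simp
  finally show ?thesis .
qed

lemma noise_concentration:
  fixes d \<delta> :: real
  defines "L \<equiv> ln (2 * real n / \<delta>)"
  assumes n: "0 < n" and \<delta>: "0 < \<delta>" "\<delta> < 1"
    and deg: "\<And>l. l < n \<Longrightarrow> (\<Sum>i<n. p (edge i l)) \<le> d" and d: "4 / 9 * L \<le> d"
  shows "1 - \<delta> \<le> measure_pmf.prob edge_pmf
           {E. numerical_radius_le n (noise E) (16 * sqrt (d * L))}"
proof -
  have ratio: "2 \<le> 2 * real n / \<delta>"
    using n \<delta> by (simp add: field_simps)
  then have "ln 2 \<le> L"
    by (simp add: L_def)
  then have L: "1 / 2 \<le> L"
    using ln2_ge_two_thirds by linarith
  then have d_pos: "0 < d"
    using d by linarith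
  define k where "k = nat \<lceil>L\<rceil>"
  have k: "0 < k" "L \<le> real k" "real k \<le> 3 * L"
    using L by (auto simp: k_def) linarith+
  have "measure_pmf.expectation edge_pmf (\<lambda>E. mat_trace (noise E ^\<^sub>m (2 * k)))
      \<le> real n * (4 * (7 * d) * real k) ^ k"
  proof (rule expectation_trace_noise_le)
    show "(\<Sum>i<n. p (edge i l)) \<le> 7 * d" if "l < n" for l
      using deg[OF that] d_pos by linarith
    show "real k \<le> 7 * d"
      using k d by linarith
  qed (fact k(1))
  also have "\<dots> \<le> \<delta> * (16 * sqrt (d * L)) ^ (2 * k)"
  proof (rule trace_bound_le_radius_power)
    show "real n \<le> \<delta> * exp L"
      using n \<delta> ratio by (simp add: L_def)
  qed (use k d_pos L \<delta> in auto)
  finally have "measure_pmf.expectation edge_pmf (\<lambda>E. mat_trace (noise E ^\<^sub>m (2 * k)))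
      / (16 * sqrt (d * L)) ^ (2 * k) \<le> \<delta>"
    using d_pos L by (simp add: field_simps)
  then show ?thesis
    using prob_numerical_radius_noise_ge[of "16 * sqrt (d * L)" k] d_pos L by simp
qed

end

section \<open>Equilibrium welfare\<close>

lemma mat_inverse_mult_vec:
  fixes M :: "'a :: field mat"
  assumes M: "M \<in> carrier_mat n n" and x: "x \<in> carrier_vec n"
    and inj: "\<And>z. z \<in> carrier_vec n \<Longrightarrow> M *\<^sub>v z = 0\<^sub>v n \<Longrightarrow> z = 0\<^sub>v n"
  shows "the (mat_inverse M) *\<^sub>v x \<in> carrier_vec n" "M *\<^sub>v (the (mat_inverse M) *\<^sub>v x) = x"
proof -
  have "Determinant.det M \<noteq> 0"
    using inj det_0_iff_vec_prod_zero_field[OF M] by blast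
  then have "M \<in> Units (ring_mat TYPE('a) n ())"
    by (rule det_non_zero_imp_unit[OF M])
  then obtain B where B: "mat_inverse M = Some B"
    using mat_inverse(1)[OF M, where b = "()"] by (cases "mat_inverse M") auto
  then have MB: "M * B = 1\<^sub>m n" "B \<in> carrier_mat n n"
    using mat_inverse(2)[OF M] by auto
  show "the (mat_inverse M) *\<^sub>v x \<in> carrier_vec n"
    using mult_mat_vec_carrier[OF MB(2) x] by (simp add: B)
  show "M *\<^sub>v (the (mat_inverse M) *\<^sub>v x) = x"
    using assoc_mult_mat_vec[OF M MB(2) x] x by (simp add: B MB(1))
qed

locale network_game =
  fixes n :: nat and \<beta> :: real and A :: "real mat" and b :: "real Matrix.vec"
  assumes A: "symmetric_mat n A" and b: "b \<in> carrier_vec n"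
    and \<beta>: "0 \<le> \<beta>" "\<beta> * lambda1 A < 1"
begin

abbreviation game_mat :: "real mat" where
  "game_mat \<equiv> 1\<^sub>m n - \<beta> \<cdot>\<^sub>m A"

definition equilibrium :: "real Matrix.vec \<Rightarrow> real Matrix.vec" where
  "equilibrium y = the (mat_inverse game_mat) *\<^sub>v (b + y)"

lemma welfare_eq: "welfare n \<beta> A b y = (vnorm (equilibrium y))\<^sup>2 / 2"
  by (simp add: welfare_def equilibrium_def)

lemma scalar_prod_game_mat:
  assumes "x \<in> carrier_vec n" "z \<in> carrier_vec n"
  shows "x \<bullet> (game_mat *\<^sub>v z) = x \<bullet> z - \<beta> * (x \<bullet> (A *\<^sub>v z))"
proof -
  have "game_mat *\<^sub>v z = z - \<beta> \<cdot>\<^sub>v (A *\<^sub>v z)"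
    using assms symmetric_mat_carrier[OF A]
    by (intro eq_vecI) (auto simp: minus_mult_distrib_mat_vec[of _ n n])
  then show ?thesis
    using assms symmetric_mat_carrier[OF A] by (simp add: scalar_prod_minus_distrib[of _ n])
qed

lemma game_mat_form_ge:
  assumes z: "z \<in> carrier_vec n"
  shows "(1 - \<beta> * lambda1 A) * (z \<bullet> z) \<le> z \<bullet> (game_mat *\<^sub>v z)"
  using mult_left_mono[OF rayleigh_le_lambda1[OF A z] \<beta>(1)]
  by (simp add: scalar_prod_game_mat[OF z z] algebra_simps)

lemma
  assumes y: "y \<in> carrier_vec n"
  shows equilibrium_carrier: "equilibrium y \<in> carrier_vec n"
    and game_mat_equilibrium: "game_mat *\<^sub>v equilibrium y = b + y"
proof -
  have game_mat: "game_mat \<in> carrier_mat n n"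
    using symmetric_mat_carrier[OF A] by (simp add: minus_carrier_mat)
  have inj: "z = 0\<^sub>v n" if z: "z \<in> carrier_vec n" and "game_mat *\<^sub>v z = 0\<^sub>v n" for z
  proof (rule ccontr)
    assume "z \<noteq> 0\<^sub>v n"
    then have "0 < (1 - \<beta> * lambda1 A) * (z \<bullet> z)"
      using vnorm_pos[OF z] \<beta>(2) by (simp flip: vnorm_squared)
    then show False
      using game_mat_form_ge[OF z] that by simp
  qed
  show "equilibrium y \<in> carrier_vec n" "game_mat *\<^sub>v equilibrium y = b + y"
    unfolding equilibrium_def using mat_inverse_mult_vec[OF game_mat _ inj] b y by simp_all
qed

lemma vnorm_equilibrium_le:
  assumes y: "y \<in> carrier_vec n"
  shows "vnorm (equilibrium y) \<le> vnorm (b + y) / (1 - \<beta> * lambda1 A)"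
proof -
  let ?z = "equilibrium y"
  note z = equilibrium_carrier[OF y]
  have "vnorm ?z * ((1 - \<beta> * lambda1 A) * vnorm ?z) \<le> ?z \<bullet> (b + y)"
    using game_mat_form_ge[OF z] vnorm_squared[of ?z]
    by (simp add: game_mat_equilibrium[OF y] power2_eq_square mult_ac)
  also have "\<dots> \<le> vnorm ?z * vnorm (b + y)"
    using abs_scalar_prod_le_vnorm[OF z, of "b + y"] b y by simp
  finally have "(1 - \<beta> * lambda1 A) * vnorm ?z \<le> vnorm (b + y)"
    using vnorm_nonneg[of ?z] vnorm_nonneg[of "b + y"]
    by (cases "vnorm ?z = 0") (simp_all add: mult_le_cancel_left_pos order_less_le)
  then show ?thesis
    using \<beta>(2) by (simp add: pos_le_divide_eq mult.commute)
qed

lemma vnorm_equilibrium_ge: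
  assumes y: "y \<in> carrier_vec n" and u: "top_unit_eigenvector n A u"
  shows "\<bar>u \<bullet> (b + y)\<bar> / (1 - \<beta> * lambda1 A) \<le> vnorm (equilibrium y)"
proof -
  let ?z = "equilibrium y"
  note z = equilibrium_carrier[OF y]
  have uc: "u \<in> carrier_vec n" "vnorm u = 1" and Au: "A *\<^sub>v u = lambda1 A \<cdot>\<^sub>v u"
    using u by (auto simp: top_unit_eigenvector_def)
  have "u \<bullet> (b + y) = (1 - \<beta> * lambda1 A) * (u \<bullet> ?z)"
    using scalar_prod_game_mat[OF uc(1) z] scalar_prod_symmetric_mat[OF A uc(1) z] uc(1) z
    by (simp add: game_mat_equilibrium[OF y] Au algebra_simps)
  moreover have "\<bar>u \<bullet> ?z\<bar> \<le> vnorm ?z"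
    using abs_scalar_prod_le_vnorm[OF uc(1) z] uc(2) by simp
  ultimately show ?thesis
    using \<beta>(2) by (simp add: abs_mult)
qed

lemma welfare_le:
  assumes y: "y \<in> carrier_vec n" "vnorm y = s"
  shows "welfare n \<beta> A b y \<le> ((vnorm b + s) / (1 - \<beta> * lambda1 A))\<^sup>2 / 2"
proof -
  have "vnorm (equilibrium y) \<le> vnorm (b + y) / (1 - \<beta> * lambda1 A)"
    by (rule vnorm_equilibrium_le[OF y(1)])
  also have "\<dots> \<le> (vnorm b + s) / (1 - \<beta> * lambda1 A)"
    using vnorm_triangle_ineq[OF b y(1)] y(2) \<beta>(2) by (simp add: divide_right_mono)
  finally show ?thesis
    by (simp add: welfare_eq power_mono vnorm_nonneg)
qed

lemma
  assumes y: "y \<in> carrier_vec n" "vnorm y = sqrt C"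
  shows opt_welfare_le: "opt_welfare n \<beta> A b C \<le> ((vnorm b + sqrt C) / (1 - \<beta> * lambda1 A))\<^sup>2 / 2"
    and welfare_le_opt_welfare: "welfare n \<beta> A b y \<le> opt_welfare n \<beta> A b C"
proof -
  let ?W = "{welfare n \<beta> A b x | x. x \<in> carrier_vec n \<and> vnorm x = sqrt C}"
  have upper: "w \<le> ((vnorm b + sqrt C) / (1 - \<beta> * lambda1 A))\<^sup>2 / 2" if "w \<in> ?W" for w
    using that welfare_le by auto
  have mem: "welfare n \<beta> A b y \<in> ?W"
    using y by blast
  show "opt_welfare n \<beta> A b C \<le> ((vnorm b + sqrt C) / (1 - \<beta> * lambda1 A))\<^sup>2 / 2"
    unfolding opt_welfare_def using mem upper by (intro cSup_least) blast+
  show "welfare n \<beta> A b y \<le> opt_welfare n \<beta> A b C"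
    unfolding opt_welfare_def using mem upper by (intro cSup_upper bdd_aboveI)
qed

lemma competitive_ratio_ge:
  assumes y: "y \<in> carrier_vec n" "vnorm y = sqrt C" and u: "top_unit_eigenvector n A u"
  shows "(u \<bullet> (b + y) / (vnorm b + sqrt C))\<^sup>2 \<le> competitive_ratio n \<beta> A b C y"
proof -
  define g where "g = 1 - \<beta> * lambda1 A"
  have g: "0 < g"
    using \<beta>(2) by (simp add: g_def)
  have "(\<bar>u \<bullet> (b + y)\<bar> / g)\<^sup>2 \<le> (vnorm (equilibrium y))\<^sup>2"
    using vnorm_equilibrium_ge[OF y(1) u] g by (intro power_mono) (simp_all add: g_def)
  then have lower: "(u \<bullet> (b + y) / g)\<^sup>2 / 2 \<le> welfare n \<beta> A b y"
    by (simp add: welfare_eq power_divide)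
  note upper = opt_welfare_le[OF y, folded g_def] and opt = welfare_le_opt_welfare[OF y]
  show ?thesis
  proof (cases "opt_welfare n \<beta> A b C = 0")
    case True
    then have "(u \<bullet> (b + y) / g)\<^sup>2 \<le> 0"
      using lower opt by linarith
    then show ?thesis
      using True g by (simp add: competitive_ratio_def)
  next
    case False
    moreover have "0 \<le> welfare n \<beta> A b y"
      by (simp add: welfare_eq)
    ultimately have pos: "0 < opt_welfare n \<beta> A b C"
      using opt by linarith
    have "(u \<bullet> (b + y) / (vnorm b + sqrt C))\<^sup>2 =
        ((u \<bullet> (b + y) / g)\<^sup>2 / 2) / (((vnorm b + sqrt C) / g)\<^sup>2 / 2)"
      using g by (simp add: power_divide)
    also have "\<dots> \<le> welfare n \<beta> A b y / opt_welfare n \<beta> A b C"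
      using lower upper pos by (intro frac_le) (simp_all add: welfare_eq)
    finally show ?thesis
      by (simp add: competitive_ratio_def)
  qed
qed

lemma eventually_competitive_ratio_ge:
  assumes u: "top_unit_eigenvector n A u" and v: "v \<in> carrier_vec n" "vnorm v = 1"
    and r: "r < (u \<bullet> v)\<^sup>2"
  shows "\<forall>\<^sub>F C in at_top. r \<le> competitive_ratio n \<beta> A b C (sqrt C \<cdot>\<^sub>v v)"
proof -
  define f where "f s = (u \<bullet> b * inverse s + u \<bullet> v) / (vnorm b * inverse s + 1)" for s
  have "((\<lambda>C. (f (sqrt C))\<^sup>2) \<longlongrightarrow> ((u \<bullet> b * 0 + u \<bullet> v) / (vnorm b * 0 + 1))\<^sup>2) at_top"
    unfolding f_def
    by (intro tendsto_intros
        filterlim_compose[OF tendsto_inverse_0_at_top[OF filterlim_ident] sqrt_at_top]) simp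
  then have "\<forall>\<^sub>F C in at_top. r < (f (sqrt C))\<^sup>2"
    using r by (intro order_tendstoD(1)) auto
  moreover have "\<forall>\<^sub>F C in at_top. 0 < (C :: real)"
    by (rule eventually_gt_at_top)
  ultimately show ?thesis
  proof eventually_elim
    case (elim C)
    then have s: "0 < sqrt C" by simp
    have "u \<bullet> (b + sqrt C \<cdot>\<^sub>v v) = sqrt C * (u \<bullet> b * inverse (sqrt C) + u \<bullet> v)"
      using u b v(1) s
      by (simp add: top_unit_eigenvector_def scalar_prod_add_distrib[of _ n] distrib_left mult_ac)
    moreover have "vnorm b + sqrt C = sqrt C * (vnorm b * inverse (sqrt C) + 1)"
      using s by (simp add: distrib_left mult_ac)
    ultimately have "u \<bullet> (b + sqrt C \<cdot>\<^sub>v v) / (vnorm b + sqrt C) = f (sqrt C)"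
      using s by (simp add: f_def)
    then show ?case
      using competitive_ratio_ge[OF _ _ u, of "sqrt C \<cdot>\<^sub>v v" C] elim v
      by (simp add: vnorm_smult[OF v(1)])
  qed
qed

end

section \<open>Random graphs with concentration\<close>

lemma edge_prob_matrix_symmetric: "edge_prob_matrix n Ab \<Longrightarrow> symmetric_mat n Ab"
  by (auto simp: edge_prob_matrix_def intro: symmetric_matI)

lemma edge_prob_matrix_edge:
  assumes "edge_prob_matrix n Ab" "i < n" "j < n"
  shows "Ab $$ edge i j = Ab $$ (i, j)"
  using symmetric_mat_index[OF edge_prob_matrix_symmetric[OF assms(1)] assms(2,3)]
  by (simp add: edge_def min_def max_def)

lemma random_graph_eq:
  "random_graph n Ab = map_pmf (\<lambda>E. edge_mat n (\<lambda>e. of_bool (E e)))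
     (Pi_pmf (edges n) False (\<lambda>e. bernoulli_pmf (Ab $$ e)))"
  by (simp add: random_graph_def edge_mat_def edge_def edges_def case_prod_unfold of_bool_def)

lemma random_graph_concentration:
  fixes \<delta> :: real
  assumes Ab: "edge_prob_matrix n Ab" and n: "0 < n" and \<delta>: "0 < \<delta>" "\<delta> < 1"
    and d: "4 / 9 * ln (2 * real n / \<delta>) \<le> d_max n Ab"
  shows "1 - \<delta> \<le> measure_pmf.prob (random_graph n Ab)
    {A. symmetric_mat n A \<and>
        numerical_radius_le n (A - Ab) (16 * sqrt (d_max n Ab * ln (2 * real n / \<delta>)))}"
proof -
  interpret random_edges n "\<lambda>e. Ab $$ e"
    using Ab by unfold_locales (auto simp: edges_def edge_prob_matrix_def)
  have deg: "(\<Sum>i<n. Ab $$ edge i l) \<le> d_max n Ab" if l: "l < n" for l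
  proof -
    have "(\<Sum>i<n. Ab $$ edge i l) = (\<Sum>j<n. Ab $$ (l, j))"
      using edge_prob_matrix_edge[OF Ab l] by (simp add: edge_commute[of _ l])
    also have "\<dots> \<le> d_max n Ab"
      unfolding d_max_def using l by (intro Max_ge) auto
    finally show ?thesis .
  qed
  have noise_eq: "noise E = edge_mat n (\<lambda>e. of_bool (E e)) - Ab" for E
    using symmetric_mat_carrier[OF edge_prob_matrix_symmetric[OF Ab]]
    by (intro eq_matI) (auto simp: noise_def edge_mat_def edge_prob_matrix_edge[OF Ab])
  show ?thesis
    using noise_concentration[OF n \<delta> deg d]
    by (simp add: random_graph_eq symmetric_edge_mat noise_eq edge_pmf_def vimage_def)
qed

locale concentrated_random_graph =
  fixes n :: nat and Ab :: "real mat" and \<epsilon> \<delta> :: real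
  assumes n: "0 < n" and Ab: "edge_prob_matrix n Ab"
    and \<epsilon>: "0 < \<epsilon>" "\<epsilon> < 1" and \<delta>: "0 < \<delta>" "\<delta> < 1"
    and concentration: "concentration n Ab \<epsilon> \<delta>"
begin

definition deviation :: real where
  "deviation = 16 * sqrt (d_max n Ab * ln (2 * real n / \<delta>))"

lemma prob_numerical_radius_deviation_ge:
  "1 - \<delta> \<le> measure_pmf.prob (random_graph n Ab)
    {A. symmetric_mat n A \<and> numerical_radius_le n (A - Ab) deviation}"
  using concentration random_graph_concentration[OF Ab n \<delta>]
  by (simp add: concentration_def deviation_def)

lemma top_unit_eigenvector_v1_mean: "top_unit_eigenvector n Ab (v1 Ab)"
  using Ab n
  by (intro top_unit_eigenvector_v1 edge_prob_matrix_symmetric) (simp_all add: edge_prob_matrix_def)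

lemma spectral_gap_ge_deviation:
  obtains \<kappa> where "inv_gap_le Ab \<kappa>" "\<kappa> * lambda1 Ab < lambda1 Ab"
    and "32 * deviation \<le> \<epsilon>\<^sup>2 * (lambda1 Ab - \<kappa> * lambda1 Ab)"
proof -
  obtain \<kappa> where d: "4 / 9 * ln (2 * real n / \<delta>) \<le> d_max n Ab" and \<kappa>: "\<kappa> < 1" "inv_gap_le Ab \<kappa>"
    and "1024 * sqrt (d_max n Ab * ln (2 * real n / \<delta>)) / \<epsilon>\<^sup>2 \<le> lambda1 Ab * (1 - \<kappa>\<^sup>2)"
    using concentration unfolding concentration_def by blast
  then have gap: "64 * deviation / \<epsilon>\<^sup>2 \<le> lambda1 Ab * (1 - \<kappa>\<^sup>2)"
    by (simp add: deviation_def)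
  have "0 < ln (2 * real n / \<delta>)"
    using n \<delta> by (simp add: field_simps)
  then have "0 < 64 * deviation / \<epsilon>\<^sup>2"
    using d \<epsilon> by (simp add: deviation_def)
  then have "lambda1 Ab \<noteq> 0"
    using gap by auto
  moreover have nonneg: "0 \<le> lambda1 Ab"
    using Ab n by (intro lambda1_nonneg[OF edge_prob_matrix_symmetric[OF Ab] n])
      (simp add: edge_prob_matrix_def)
  ultimately have "\<kappa> * lambda1 Ab < lambda1 Ab"
    using \<kappa>(1) by simp
  moreover have "1 - \<kappa>\<^sup>2 \<le> 2 * (1 - \<kappa>)"
    using zero_le_power2[of "1 - \<kappa>"] by (simp add: power2_diff)
  then have "64 * deviation / \<epsilon>\<^sup>2 \<le> lambda1 Ab * (2 * (1 - \<kappa>))"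
    using gap nonneg by (meson mult_left_mono order_trans)
  then have "32 * deviation \<le> \<epsilon>\<^sup>2 * (lambda1 Ab - \<kappa> * lambda1 Ab)"
    using \<epsilon> by (simp add: field_simps)
  ultimately show thesis
    using that \<kappa>(2) by blast
qed

lemma top_unit_eigenvector_overlap:
  assumes A: "symmetric_mat n A" and close: "numerical_radius_le n (A - Ab) deviation"
    and u: "top_unit_eigenvector n A u" and v: "top_unit_eigenvector n Ab v"
  shows "1 - \<epsilon> < (u \<bullet> v)\<^sup>2"
proof -
  obtain \<kappa> where \<kappa>: "inv_gap_le Ab \<kappa>" "\<kappa> * lambda1 Ab < lambda1 Ab"
    and gap: "32 * deviation \<le> \<epsilon>\<^sup>2 * (lambda1 Ab - \<kappa> * lambda1 Ab)"
    using spectral_gap_ge_deviation .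
  have other: "e \<le> \<kappa> * lambda1 Ab" if "e \<in># other_eigvals Ab" for e
    using \<kappa>(1) that by (force simp: inv_gap_le_def)
  have "(1 - (u \<bullet> v)\<^sup>2) * (lambda1 Ab - \<kappa> * lambda1 Ab) \<le> 2 * deviation"
    by (rule top_unit_eigenvector_perturbation
        [OF A edge_prob_matrix_symmetric[OF Ab] u v other \<kappa>(2) close])
  also have "\<dots> \<le> \<epsilon>\<^sup>2 / 16 * (lambda1 Ab - \<kappa> * lambda1 Ab)"
    using gap by simp
  finally have "1 - (u \<bullet> v)\<^sup>2 \<le> \<epsilon>\<^sup>2 / 16"
    by (rule mult_right_le_imp_le) (use \<kappa>(2) in simp)
  also have "\<dots> < \<epsilon>"
    using \<epsilon> by (simp add: power2_eq_square)
  finally show ?thesis by simp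
qed

lemma competitive_ratio_v1_ge_for_large_budgets:
  assumes A: "symmetric_mat n A" and close: "numerical_radius_le n (A - Ab) deviation"
    and radius: "spectral_radius (map_mat complex_of_real A) < 1 / \<beta>" and \<beta>: "0 < \<beta>"
    and b: "b \<in> carrier_vec n"
  shows "\<exists>C0>0. \<forall>C\<ge>C0. 1 - \<epsilon> \<le> competitive_ratio n \<beta> A b C (sqrt C \<cdot>\<^sub>v v1 Ab)"
proof -
  have "lambda1 A < 1 / \<beta>"
    using lambda1_le_spectral_radius[OF A n] radius by linarith
  then interpret network_game n \<beta> A b
    using A b \<beta> by unfold_locales (simp_all add: field_simps)
  obtain u where u: "top_unit_eigenvector n A u"
    using top_unit_eigenvector_exists[OF A n] .
  have "\<forall>\<^sub>F C in at_top. 1 - \<epsilon> \<le> competitive_ratio n \<beta> A b C (sqrt C \<cdot>\<^sub>v v1 Ab)"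
    using top_unit_eigenvector_v1_mean
      top_unit_eigenvector_overlap[OF A close u top_unit_eigenvector_v1_mean]
    by (intro eventually_competitive_ratio_ge[OF u]) (auto simp: top_unit_eigenvector_def)
  then have "\<forall>\<^sub>F C0 in at_top. 0 < C0 \<and>
      (\<forall>C\<ge>C0. 1 - \<epsilon> \<le> competitive_ratio n \<beta> A b C (sqrt C \<cdot>\<^sub>v v1 Ab))"
    by (intro eventually_conj eventually_gt_at_top eventually_all_ge_at_top)
  then show ?thesis
    using eventually_happens'[OF trivial_limit_at_top_linorder] by blast
qed

end

theorem theorem1:
  fixes n :: nat and Ab :: "real mat" and \<epsilon> \<delta> \<beta> :: real and b :: "real Matrix.vec"
  assumes "0 < n"
    and "edge_prob_matrix n Ab"
    and "0 < \<epsilon>" "\<epsilon> < 1" "0 < \<delta>" "\<delta> < 1"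
    and "concentration n Ab \<epsilon> \<delta>"
    and "0 < \<beta>"
    and "b \<in> carrier_vec n" "\<forall>i<n. vec_index b i \<ge> 0"
  shows "measure_pmf.prob (random_graph n Ab)
           {A. spectral_radius (map_mat complex_of_real A) < 1 / \<beta> \<longrightarrow>
               (\<exists>C0>0. \<forall>C\<ge>C0.
                  competitive_ratio n \<beta> A b C (sqrt C \<cdot>\<^sub>v v1 Ab) \<ge> 1 - \<epsilon>)}
         \<ge> 1 - \<delta>"
proof -
  interpret concentrated_random_graph n Ab \<epsilon> \<delta>
    using assms by unfold_locales
  let ?goal = "{A. spectral_radius (map_mat complex_of_real A) < 1 / \<beta> \<longrightarrow>
    (\<exists>C0>0. \<forall>C\<ge>C0. competitive_ratio n \<beta> A b C (sqrt C \<cdot>\<^sub>v v1 Ab) \<ge> 1 - \<epsilon>)}"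
  have "1 - \<delta> \<le> measure_pmf.prob (random_graph n Ab)
      {A. symmetric_mat n A \<and> numerical_radius_le n (A - Ab) deviation}"
    by (rule prob_numerical_radius_deviation_ge)
  also have "\<dots> \<le> measure_pmf.prob (random_graph n Ab) ?goal"
    using competitive_ratio_v1_ge_for_large_budgets[OF _ _ _ \<open>0 < \<beta>\<close> \<open>b \<in> carrier_vec n\<close>]
    by (intro measure_pmf.finite_measure_mono) auto
  finally show ?thesis .
qed

end
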